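(* Consider sparse linear regression: samples $\xi_i=(x_i,y_i)$ obey $y_i=\bar w^\top x_i+\varepsilon_i$ with a $k$-sparse $\bar w\in\mathbb R^p$. Assume that the $\varepsilon_i$ are i.i.d. zero-mean $\sigma^2$-sub-Gaussian and the $x_i$ are i.i.d. from a zero-mean sub-Gaussian distribution with covariance matrix $\Sigma\succ0$ and $\Sigma_{jj}\le1$ for all $j$. Let $\delta_n=\sigma^2(72+16\log p)/n$. Then there exist universal constants $c_0,c_1>0$ such that when $n\ge4kc_1\log(p)/\lambda_{\min}(\Sigma)$, for any $\delta\in(0,1-\exp\{-c_0n\})$, with probability at least $1-\delta-\exp\{-c_0n\}$, \[ F(w_{S,k})-F(\bar w)\le\mathcal O\left(\frac{k\sigma^2\log(p/\delta)}{n\lambda_{\min}^2(\Sigma)}\right). \] Moreover, suppose that the domain $\mathcal W$ is bounded by $R$ (i.e. $\|w\|\le R$ for $w\in\mathcal W$) and $\|x_i\|\le1$. If $n$ is sufficiently large such that $\exp\{-c_0n\}\le\min\left\{0.5,\frac{\delta_n}{4R^2}\right\}$, then \[ \mathbb E_S\left[F(w_{S,k})-F(\bar w)\right]\le\mathbb E_S\left[F(w_{S,k})-F_S(w_{S,k})\right]\le\mathcal O\left(\frac{k\sigma^2\log(p)}{n\lambda_{\min}^2(\Sigma)}\right). \]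
   Context: The loss is $\ell(w;(x,y))=\frac12(y-w^\top x)^2$; $S=\{(x_i,y_i)\}_{i=1}^n$, $F_S(w)=\frac1{2n}\sum_{i=1}^n(y_i-w^\top x_i)^2$, and $F(w)=\mathbb E[\ell(w;(x,y))]$ with $(x,y)$ distributed as one sample. The noise $\varepsilon_i$ is independent of $x_i$. $\mathcal W\subseteq\mathbb R^p$ is the parameter domain (containing $\bar w$). $\|w\|_0$ is the number of nonzero entries ($k$-sparse means $\|w\|_0\le k$), $\|\cdot\|$ the Euclidean norm, $\lambda_{\min}$ the smallest eigenvalue. $w_{S,k}$ is a minimizer of $F_S$ over $\{w\in\mathcal W:\|w\|_0\le k\}$. A real random variable $X$ is zero-mean $\sigma^2$-sub-Gaussian if $\mathbb E[X]=0$ and $\mathbb E[e^{tX}]\le e^{\sigma^2t^2/2}$ for all $t\in\mathbb R$. A random vector $x$ is zero-mean sub-Gaussian with covariance $\Sigma$ if $\mathbb E[x]=0$, $\mathbb E[xx^\top]=\Sigma$ and $\mathbb E[e^{v^\top x}]\le e^{v^\top\Sigma v/2}$ for all $v\in\mathbb R^p$. Convention: $A\le\mathcal O(X)$ means $A\le CX$ for a constant $C>0$ not depending on $n,p,k,\delta$ or $S$, the remaining parameters ($\sigma,\Sigma$ through its extreme eigenvalues, $R$) being regarded as fixed; $p\ge2$ is understood. *)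

theory Defs
  imports "HOL-Probability.Probability" "Jordan_Normal_Form.Spectral_Radius"
begin

text \<open>
  The dimension \<open>p\<close> has to be quantified inside the statement, below the constant hidden in the
  big-O. Vectors of dimension \<open>p\<close> are therefore functions \<open>nat \<Rightarrow> real\<close> on the index set \<open>{..<p}\<close>
  (extensional where they are elements of a measure space or of the parameter domain), and the
  Borel sets of \<open>p\<close>-space are those of \<open>borel_vec p\<close>. The Euclidean norm is \<open>L2_set w {..<p}\<close>.
\<close>

abbreviation borel_vec :: "nat \<Rightarrow> (nat \<Rightarrow> real) measure" where
  "borel_vec p \<equiv> PiM {..<p} (\<lambda>_. borel)"

definition dot :: "nat \<Rightarrow> (nat \<Rightarrow> real) \<Rightarrow> (nat \<Rightarrow> real) \<Rightarrow> real" where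
  "dot p v w = (\<Sum>j<p. v j * w j)"

definition l0_norm :: "nat \<Rightarrow> (nat \<Rightarrow> real) \<Rightarrow> nat" where
  "l0_norm p w = card {j \<in> {..<p}. w j \<noteq> 0}"

definition quad_form :: "nat \<Rightarrow> real mat \<Rightarrow> (nat \<Rightarrow> real) \<Rightarrow> real" where
  "quad_form p A v = (\<Sum>i<p. \<Sum>j<p. v i * A $$ (i, j) * v j)"

definition pos_definite :: "nat \<Rightarrow> real mat \<Rightarrow> bool" where
  "pos_definite p A \<longleftrightarrow> A \<in> carrier_mat p p \<and> transpose_mat A = A \<and>
     (\<forall>v. (\<exists>j<p. v j \<noteq> 0) \<longrightarrow> 0 < quad_form p A v)"

text \<open>Only used for symmetric matrices of positive dimension, whose real spectrum is nonempty.\<close>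

definition lambda_min :: "real mat \<Rightarrow> real" where
  "lambda_min A = Min (spectrum A)"

definition lambda_max :: "real mat \<Rightarrow> real" where
  "lambda_max A = Max (spectrum A)"

text \<open>
  The integrability clauses say that the expectations exist: the Bochner integral of a
  non-integrable function is 0, which would make the bounds on it void.
\<close>

definition subgaussian :: "real measure \<Rightarrow> real \<Rightarrow> bool" where
  "subgaussian D s \<longleftrightarrow>
     integrable D (\<lambda>e. e) \<and> (\<integral>e. e \<partial>D) = 0 \<and>
     (\<forall>t. integrable D (\<lambda>e. exp (t * e)) \<and> (\<integral>e. exp (t * e) \<partial>D) \<le> exp (s * t\<^sup>2 / 2))"

definition subgaussian_vec :: "nat \<Rightarrow> (nat \<Rightarrow> real) measure \<Rightarrow> real mat \<Rightarrow> bool" where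
  "subgaussian_vec p D A \<longleftrightarrow>
     (\<forall>i<p. integrable D (\<lambda>x. x i) \<and> (\<integral>x. x i \<partial>D) = 0) \<and>
     (\<forall>i<p. \<forall>j<p. integrable D (\<lambda>x. x i * x j) \<and> (\<integral>x. x i * x j \<partial>D) = A $$ (i, j)) \<and>
     (\<forall>v. integrable D (\<lambda>x. exp (dot p v x)) \<and>
          (\<integral>x. exp (dot p v x) \<partial>D) \<le> exp (quad_form p A v / 2))"

definition loss :: "nat \<Rightarrow> (nat \<Rightarrow> real) \<Rightarrow> (nat \<Rightarrow> real) \<times> real \<Rightarrow> real" where
  "loss p w z = (snd z - dot p w (fst z))\<^sup>2 / 2"

definition risk :: "nat \<Rightarrow> ((nat \<Rightarrow> real) \<times> real) measure \<Rightarrow> (nat \<Rightarrow> real) \<Rightarrow> real" where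
  "risk p D w = (\<integral>z. loss p w z \<partial>D)"

definition emp_risk ::
  "nat \<Rightarrow> nat \<Rightarrow> (nat \<Rightarrow> (nat \<Rightarrow> real) \<times> real) \<Rightarrow> (nat \<Rightarrow> real) \<Rightarrow> real" where
  "emp_risk p n S w = 1 / (2 * real n) * (\<Sum>i<n. (snd (S i) - dot p w (fst (S i)))\<^sup>2)"

text \<open>
  Law of one observation \<open>(x, dot p wbar x + e)\<close>, where \<open>x\<close> has law \<open>Dx\<close> and the noise \<open>e\<close>,
  independent of \<open>x\<close>, has law \<open>De\<close>.
\<close>

definition obs_law ::
  "nat \<Rightarrow> (nat \<Rightarrow> real) \<Rightarrow> (nat \<Rightarrow> real) measure \<Rightarrow> real measure \<Rightarrow> ((nat \<Rightarrow> real) \<times> real) measure"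
  where
  "obs_law p wbar Dx De =
     distr (Dx \<Otimes>\<^sub>M De) (borel_vec p \<Otimes>\<^sub>M borel) (\<lambda>(x, e). (x, dot p wbar x + e))"

text \<open>
  An i.i.d. sample of size \<open>n\<close> is taken on its canonical probability space. In this way no type
  variable for the underlying sample space occurs, on which the universal constants could depend.
\<close>

definition sample_law ::
  "nat \<Rightarrow> nat \<Rightarrow> (nat \<Rightarrow> real) \<Rightarrow> (nat \<Rightarrow> real) measure \<Rightarrow> real measure
    \<Rightarrow> (nat \<Rightarrow> (nat \<Rightarrow> real) \<times> real) measure" where
  "sample_law n p wbar Dx De = PiM {..<n} (\<lambda>_. obs_law p wbar Dx De)"

text \<open>
  \<open>W\<close> is the parameter domain, \<open>Cov\<close> the covariance matrix of the design, and \<open>w_hat S\<close> the chosen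
  \<open>k\<close>-sparse minimizer of the empirical risk on the sample \<open>S\<close>. Only the square of \<open>\<sigma>\<close> matters.
\<close>

locale sparse_regression =
  fixes \<sigma> :: real and p n k :: nat
    and W :: "(nat \<Rightarrow> real) set" and wbar :: "nat \<Rightarrow> real"
    and Dx :: "(nat \<Rightarrow> real) measure" and De :: "real measure" and Cov :: "real mat"
    and w_hat :: "(nat \<Rightarrow> (nat \<Rightarrow> real) \<times> real) \<Rightarrow> nat \<Rightarrow> real"
  assumes p_ge_2: "2 \<le> p"
    and n_pos: "0 < n"
    and domain: "W \<subseteq> {..<p} \<rightarrow>\<^sub>E UNIV"
    and wbar_domain: "wbar \<in> W"
    and wbar_sparse: "l0_norm p wbar \<le> k"
    and noise_prob: "prob_space De"
    and noise_sets: "sets De = sets borel"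
    and noise_subgaussian: "subgaussian De (\<sigma>\<^sup>2)"
    and design_prob: "prob_space Dx"
    and design_sets: "sets Dx = sets (borel_vec p)"
    and design_subgaussian: "subgaussian_vec p Dx Cov"
    and cov_pos_definite: "pos_definite p Cov"
    and cov_diag: "\<And>j. j < p \<Longrightarrow> Cov $$ (j, j) \<le> 1"
    and w_hat_measurable: "w_hat \<in> measurable (sample_law n p wbar Dx De) (borel_vec p)"
    and w_hat_minimizer: "AE S in sample_law n p wbar Dx De.
          is_arg_min (emp_risk p n S) (\<lambda>w. w \<in> W \<and> l0_norm p w \<le> k) (w_hat S)"

end

theory Submission
  imports Defs
begin

text \<open>
  Write \<open>\<Delta> = w_hat S - wbar\<close> and \<open>Q v = quad_form p Cov v\<close>. The noise is centred and independent of the design,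
  so the excess risk of a parameter \<open>w\<close> is \<open>Q (w - wbar) / 2\<close> (\<open>excess_risk_eq\<close>), and \<open>\<Delta>\<close> is a \<open>2k\<close>-sparse vector
  because both \<open>w_hat S\<close> and \<open>wbar\<close> are \<open>k\<close>-sparse. The optimality of \<open>w_hat S\<close> gives the basic inequality
  \<open>\<Sum>\<^sub>i \<langle>\<Delta>, x\<^sub>i\<rangle>\<^sup>2 / (2n) \<le> \<Sum>\<^sub>j \<Delta>\<^sub>j Z\<^sub>j\<close>, where \<open>Z\<^sub>j = (1/n) \<Sum>\<^sub>i x\<^sub>i\<^sub>j \<epsilon>\<^sub>i\<close> is the correlation of the noise with the
  \<open>j\<close>-th column (\<open>emp_risk_gap\<close>). Two probabilistic facts turn it into a bound on \<open>Q \<Delta>\<close>.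

  Restricted eigenvalues: outside an event of probability exponentially small in \<open>n\<close>, every \<open>2k\<close>-sparse \<open>v\<close>
  satisfies \<open>\<Sum>\<^sub>i \<bar>\<langle>v, x\<^sub>i\<rangle>\<bar> \<ge> n sqrt (Q v) / 64\<close> (\<open>restricted_eigenvalue\<close>), whence \<open>\<Sum>\<^sub>i \<langle>v, x\<^sub>i\<rangle>\<^sup>2 \<ge> n Q v / 4096\<close>
  by the Cauchy-Schwarz inequality. For one fixed \<open>v\<close> this is a Chernoff bound: a sub-Gaussian variable of
  variance one has a bounded fourth moment, hence its absolute value has a mean bounded away from zero.
  All \<open>v\<close> are treated at once by rounding them to a grid of integer vectors. The logarithm of the number of sparse
  grid points is of order \<open>k ln p / lambda_min Cov\<close>, which is what the lower bound on \<open>n\<close> pays for.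
  First absolute moments are used instead of squares because then the rounding error is controlled by
  the column sums \<open>\<Sum>\<^sub>i \<bar>x\<^sub>i\<^sub>j\<bar>\<close>, whose upper tail needs no more than a linear exponential moment.

  Noise: if \<open>\<epsilon>\<close> is \<open>\<sigma>\<^sup>2\<close>-sub-Gaussian and independent of \<open>x\<close>, then \<open>x\<^sub>j \<epsilon>\<close> has the moment generating function of a
  sub-Gaussian variable near the origin (\<open>mgf_noise_coord\<close>). So \<open>max\<^sub>j Z\<^sub>j\<^sup>2\<close> is of order \<open>\<sigma>\<^sup>2 ln (p / \<delta>) / n\<close> with
  probability \<open>1 - \<delta>\<close> (\<open>noise_corr_tail\<close>), and of order \<open>\<sigma>\<^sup>2 ln p / n\<close> in mean (\<open>noise_corr_second_moment\<close>).

  Since \<open>\<Sum>\<^sub>j \<bar>\<Delta>\<^sub>j\<bar> \<le> sqrt (2k) \<parallel>\<Delta>\<parallel> \<le> sqrt (2k Q \<Delta> / lambda_min Cov)\<close>, the basic inequality yields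
  \<open>Q \<Delta> \<le> C k max\<^sub>j Z\<^sub>j\<^sup>2 / lambda_min Cov\<close>, and the same bound for the decrease of the empirical risk from \<open>wbar\<close> to \<open>w_hat S\<close>
  (\<open>excess_and_gap_le_on_good_event\<close>). This is the first claim.

  For the second claim, \<open>F_S wbar\<close> has mean \<open>F wbar\<close>, so \<open>F (w_hat S) - F_S (w_hat S)\<close> has the mean of the excess risk
  plus that of the decrease \<open>F_S wbar - F_S (w_hat S) \<ge> 0\<close>; this gives the first inequality at once. On the good event both
  terms are controlled as above. On the bad event the boundedness of the domain
  gives \<open>4 R\<^sup>2\<close> up to a multiple of \<open>k max\<^sub>j Z\<^sub>j\<^sup>2\<close>, and the assumption on \<open>exp (- c0 n)\<close> makes its contribution of the right order.
  When \<open>n\<close> is too small for the restricted eigenvalue bound, the claimed rate exceeds a positive constant and the trivial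
  bound on the expectation suffices.
\<close>

section \<open>Quadratic forms and the smallest eigenvalue\<close>

definition bilin_form :: "nat \<Rightarrow> real mat \<Rightarrow> (nat \<Rightarrow> real) \<Rightarrow> (nat \<Rightarrow> real) \<Rightarrow> real" where
  "bilin_form p A u v = (\<Sum>i<p. \<Sum>j<p. u i * A $$ (i, j) * v j)"

lemma quad_form_eq_bilin: "quad_form p A v = bilin_form p A v v"
  by (simp add: quad_form_def bilin_form_def)

lemma bilin_form_add_right:
  "bilin_form p A u (\<lambda>j. v j + c * w j) = bilin_form p A u v + c * bilin_form p A u w"
  by (simp add: bilin_form_def algebra_simps sum.distrib sum_distrib_left)

lemma bilin_form_commute:
  assumes "A \<in> carrier_mat p p" "transpose_mat A = A"
  shows "bilin_form p A u v = bilin_form p A v u"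
proof -
  have sym: "A $$ (i, j) = A $$ (j, i)" if "i < p" "j < p" for i j
    using assms that by (metis carrier_matD index_transpose_mat(1))
  have "bilin_form p A u v = (\<Sum>j<p. \<Sum>i<p. u i * A $$ (i, j) * v j)"
    unfolding bilin_form_def by (rule sum.swap)
  also have "\<dots> = bilin_form p A v u"
    unfolding bilin_form_def by (intro sum.cong refl) (simp add: sym mult_ac)
  finally show ?thesis .
qed

lemma quad_form_add:
  assumes "A \<in> carrier_mat p p" "transpose_mat A = A"
  shows "quad_form p A (\<lambda>j. u j + c * v j)
    = quad_form p A u + 2 * c * bilin_form p A u v + c\<^sup>2 * quad_form p A v"
proof -
  have "quad_form p A (\<lambda>j. u j + c * v j)
      = bilin_form p A (\<lambda>j. u j + c * v j) u + c * bilin_form p A (\<lambda>j. u j + c * v j) v"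
    unfolding quad_form_eq_bilin by (rule bilin_form_add_right)
  also have "\<dots> = bilin_form p A u (\<lambda>j. u j + c * v j) + c * bilin_form p A v (\<lambda>j. u j + c * v j)"
    by (simp add: bilin_form_commute[OF assms])
  also have "\<dots> = quad_form p A u + 2 * c * bilin_form p A u v + c\<^sup>2 * quad_form p A v"
    using bilin_form_commute[OF assms, of u v]
    by (simp add: bilin_form_add_right quad_form_eq_bilin algebra_simps power2_eq_square)
  finally show ?thesis .
qed

lemma quad_form_scale: "quad_form p A (\<lambda>j. c * v j) = c\<^sup>2 * quad_form p A v"
  by (simp add: quad_form_def sum_distrib_left power2_eq_square mult_ac)

text \<open>
  The quadratic polynomial \<open>c \<mapsto> Q (u + c v)\<close> is nonnegative, so its discriminant is not positive.
\<close>

lemma bilin_form_Cauchy_Schwarz: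
  assumes A: "A \<in> carrier_mat p p" "transpose_mat A = A"
    and psd: "\<And>v. 0 \<le> quad_form p A v"
  shows "(bilin_form p A u v)\<^sup>2 \<le> quad_form p A u * quad_form p A v"
proof -
  let ?b = "bilin_form p A u v" and ?a = "quad_form p A v"
  have nn: "0 \<le> quad_form p A u + 2 * c * ?b + c\<^sup>2 * ?a" for c
    using psd[of "\<lambda>j. u j + c * v j"] by (simp add: quad_form_add[OF A])
  show ?thesis
  proof (cases "?a = 0")
    case True
    have "?b = 0"
    proof (rule ccontr)
      assume "?b \<noteq> 0"
      then show False
        using nn[of "- (quad_form p A u + 1) / (2 * ?b)"] True by (simp add: field_simps)
    qed
    then show ?thesis using True by simp
  next
    case False
    then have pos: "0 < ?a" using psd[of v] by simp
    have "0 \<le> quad_form p A u - ?b\<^sup>2 / ?a"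
      using nn[of "- ?b / ?a"] pos by (simp add: power2_eq_square field_simps)
    then show ?thesis using pos by (simp add: field_simps)
  qed
qed

lemma sqrt_quad_form_triangle:
  assumes A: "A \<in> carrier_mat p p" "transpose_mat A = A"
    and psd: "\<And>v. 0 \<le> quad_form p A v"
  shows "sqrt (quad_form p A (\<lambda>j. u j + v j)) \<le> sqrt (quad_form p A u) + sqrt (quad_form p A v)"
proof -
  have "bilin_form p A u v \<le> sqrt (quad_form p A u * quad_form p A v)"
    using bilin_form_Cauchy_Schwarz[OF assms, of u v] by (rule real_le_rsqrt)
  then have "quad_form p A (\<lambda>j. u j + v j) \<le> (sqrt (quad_form p A u) + sqrt (quad_form p A v))\<^sup>2"
    using quad_form_add[OF A, of u 1 v] psd[of u] psd[of v]
    by (simp add: power2_sum real_sqrt_mult)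
  then show ?thesis
    using psd by (intro real_le_lsqrt) auto
qed

text \<open>
  A positive semidefinite matrix with diagonal entries at most one has all its entries in \<open>[-1, 1]\<close>: apply the
  Cauchy-Schwarz inequality to pairs of unit vectors. This controls the effect of rounding on \<open>sqrt Q\<close>.
\<close>

lemma quad_form_l1_bound:
  assumes A: "A \<in> carrier_mat p p" "transpose_mat A = A"
    and psd: "\<And>v. 0 \<le> quad_form p A v"
    and diag: "\<And>j. j < p \<Longrightarrow> A $$ (j, j) \<le> 1"
  shows "sqrt (quad_form p A v) \<le> (\<Sum>j<p. \<bar>v j\<bar>)"
proof -
  define e where "e i = (\<lambda>j. if j = i then 1 else (0::real))" for i :: nat
  have Be: "bilin_form p A (e i) (e j) = A $$ (i, j)" if "i < p" "j < p" for i j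
  proof -
    have "(\<Sum>b<p. e i a * A $$ (a, b) * e j b) = (if a = i then A $$ (a, j) else 0)" for a
    proof -
      have "(\<Sum>b<p. e i a * A $$ (a, b) * e j b) = (\<Sum>b<p. if b = j then e i a * A $$ (a, b) else 0)"
        by (intro sum.cong refl) (auto simp: e_def)
      then show ?thesis using that by (simp add: e_def)
    qed
    then have "bilin_form p A (e i) (e j) = (\<Sum>a<p. if a = i then A $$ (a, j) else 0)"
      by (simp add: bilin_form_def)
    also have "\<dots> = A $$ (i, j)" using that by simp
    finally show ?thesis .
  qed
  have entry: "\<bar>A $$ (i, j)\<bar> \<le> 1" if "i < p" "j < p" for i j
  proof -
    have "(A $$ (i, j))\<^sup>2 \<le> A $$ (i, i) * A $$ (j, j)"
      using bilin_form_Cauchy_Schwarz[OF A psd, of "e i" "e j"] that by (simp add: quad_form_eq_bilin Be)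
    also have "\<dots> \<le> 1 * 1"
      using diag that psd[of "e j"] by (intro mult_mono) (auto simp: quad_form_eq_bilin Be)
    finally show ?thesis by (simp add: abs_square_le_1)
  qed
  have "quad_form p A v \<le> (\<Sum>i<p. \<Sum>j<p. \<bar>v i\<bar> * \<bar>v j\<bar>)"
    unfolding quad_form_def
  proof (intro sum_mono)
    fix i j assume ij: "i \<in> {..<p}" "j \<in> {..<p}"
    have "v i * A $$ (i, j) * v j \<le> \<bar>v i\<bar> * \<bar>v j\<bar> * \<bar>A $$ (i, j)\<bar>"
      using abs_ge_self[of "v i * A $$ (i, j) * v j"] by (simp add: abs_mult mult_ac)
    also have "\<dots> \<le> \<bar>v i\<bar> * \<bar>v j\<bar> * 1"
      using entry[of i j] ij by (intro mult_left_mono) auto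
    finally show "v i * A $$ (i, j) * v j \<le> \<bar>v i\<bar> * \<bar>v j\<bar>" by simp
  qed
  also have "\<dots> = (\<Sum>j<p. \<bar>v j\<bar>)\<^sup>2"
    by (simp add: power2_eq_square sum_product)
  finally show ?thesis by (intro real_le_lsqrt psd) (auto intro: sum_nonneg)
qed

text \<open>
  The candidate is the infimum \<open>\<mu>\<close> of the Rayleigh quotient. The matrix \<open>B = A - \<mu> I\<close> is positive
  semidefinite. If it had an inverse \<open>C\<close>, then \<open>v = B u\<close> with \<open>u = C v\<close>, and the Cauchy-Schwarz inequality for \<open>B\<close> would give
  \<open>\<parallel>v\<parallel>\<^sup>4 = (v\<^sup>T B u)\<^sup>2 \<le> (v\<^sup>T B v) (u\<^sup>T B u) \<le> c \<parallel>v\<parallel>\<^sup>2 (v\<^sup>T B v)\<close>, so that the infimum could be raised by \<open>1/c\<close>. Hence \<open>B\<close> is singular. The argument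
  replaces the compactness of the sphere.
\<close>

lemma Rayleigh_attained_at_eigenvalue:
  assumes p: "0 < p" and A: "A \<in> carrier_mat p p" "transpose_mat A = A"
  shows "\<exists>\<mu> \<in> spectrum A. \<forall>v. \<mu> * (\<Sum>j<p. (v j)\<^sup>2) \<le> quad_form p A v"
proof -
  define nrm where "nrm v = (\<Sum>j<p. (v j)\<^sup>2)" for v :: "nat \<Rightarrow> real"
  define K where "K = (\<Sum>i<p. \<Sum>j<p. \<bar>A $$ (i, j)\<bar>)"
  have nrm_nn: "0 \<le> nrm v" for v by (simp add: nrm_def sum_nonneg)
  have nrm_scale: "nrm (\<lambda>j. c * v j) = c\<^sup>2 * nrm v" for c v
    by (simp add: nrm_def power_mult_distrib sum_distrib_left)
  have Kbd: "\<bar>bilin_form p M v v\<bar> \<le> (\<Sum>i<p. \<Sum>j<p. \<bar>M $$ (i, j)\<bar>) * nrm v" for M v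
  proof -
    have "\<bar>bilin_form p M v v\<bar> \<le> (\<Sum>i<p. \<Sum>j<p. \<bar>v i * M $$ (i, j) * v j\<bar>)"
      unfolding bilin_form_def by (intro order.trans[OF sum_abs] sum_mono order.refl)
    also have "\<dots> \<le> (\<Sum>i<p. \<Sum>j<p. \<bar>M $$ (i, j)\<bar> * nrm v)"
    proof (intro sum_mono)
      fix i j assume ij: "i \<in> {..<p}" "j \<in> {..<p}"
      have sq: "(v i)\<^sup>2 \<le> nrm v" if "i \<in> {..<p}" for i
        unfolding nrm_def using that by (intro member_le_sum) auto
      have "2 * \<bar>v i * v j\<bar> \<le> (v i)\<^sup>2 + (v j)\<^sup>2"
        using sum_squares_bound[of "\<bar>v i\<bar>" "\<bar>v j\<bar>"] by (simp add: abs_mult)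
      then have "\<bar>v i * v j\<bar> \<le> nrm v" using sq[OF ij(1)] sq[OF ij(2)] by linarith
      then have "\<bar>M $$ (i, j)\<bar> * \<bar>v i * v j\<bar> \<le> \<bar>M $$ (i, j)\<bar> * nrm v" by (intro mult_left_mono) auto
      then show "\<bar>v i * M $$ (i, j) * v j\<bar> \<le> \<bar>M $$ (i, j)\<bar> * nrm v" by (simp add: abs_mult mult_ac)
    qed
    finally show ?thesis by (simp add: sum_distrib_right)
  qed
  define S where "S = quad_form p A ` {v. nrm v = 1}"
  define \<mu> where "\<mu> = Inf S"
  have "nrm (\<lambda>j. if j = 0 then 1 else 0) = 1"
    using p by (simp add: nrm_def if_distrib[of "\<lambda>x. x\<^sup>2"] cong: if_cong)
  then have S_ne: "S \<noteq> {}" unfolding S_def by blast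
  have S_bdd: "bdd_below S"
  proof (rule bdd_belowI)
    fix x assume "x \<in> S"
    then obtain v where "nrm v = 1" "x = bilin_form p A v v" by (auto simp: S_def quad_form_eq_bilin)
    then show "- K \<le> x" using Kbd[of A v] by (simp add: K_def)
  qed
  have low: "\<mu> * nrm v \<le> quad_form p A v" for v
  proof (cases "nrm v = 0")
    case True
    then have "\<forall>j<p. v j = 0" by (simp add: nrm_def sum_nonneg_eq_0_iff)
    then show ?thesis using True by (simp add: quad_form_def)
  next
    case False
    then have pos: "0 < nrm v" using nrm_nn[of v] by simp
    let ?c = "1 / sqrt (nrm v)"
    have "nrm (\<lambda>j. ?c * v j) = 1" unfolding nrm_scale using pos by (simp add: power_divide)
    then have "\<mu> \<le> quad_form p A (\<lambda>j. ?c * v j)"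
      unfolding \<mu>_def by (intro cInf_lower S_bdd) (auto simp: S_def)
    also have "\<dots> = quad_form p A v / nrm v"
      unfolding quad_form_scale using pos by (simp add: power_divide)
    finally show ?thesis using pos by (simp add: field_simps)
  qed
  define B where "B = char_matrix A \<mu>"
  have B: "B \<in> carrier_mat p p" using A by (simp add: B_def)
  have B_entry: "B $$ (i, j) = A $$ (i, j) - (if i = j then \<mu> else 0)" if "i < p" "j < p" for i j
    using A that by (simp add: B_def char_matrix_def)
  have B_sym: "transpose_mat B = B"
  proof -
    have "A $$ (i, j) = A $$ (j, i)" if "i < p" "j < p" for i j
      using A that by (metis carrier_matD index_transpose_mat(1))
    then show ?thesis using B by (intro eq_matI) (auto simp: B_entry)
  qed
  have B_quad: "quad_form p B v = quad_form p A v - \<mu> * nrm v" for v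
  proof -
    have "quad_form p B v = (\<Sum>i<p. \<Sum>j<p. v i * A $$ (i, j) * v j - (if i = j then \<mu> * (v i)\<^sup>2 else 0))"
      unfolding quad_form_def by (intro sum.cong refl) (auto simp: B_entry algebra_simps power2_eq_square)
    then show ?thesis
      by (simp add: quad_form_def sum_subtractf nrm_def sum_distrib_left)
  qed
  have B_psd: "0 \<le> quad_form p B v" for v using low[of v] by (simp add: B_quad)
  have "Determinant.det B = 0"
  proof (rule ccontr)
    assume "Determinant.det B \<noteq> 0"
    from det_non_zero_imp_unit[OF B this, of "()"]
    obtain C where C: "C \<in> carrier_mat p p" "B * C = 1\<^sub>m p"
      by (auto simp: Units_def ring_mat_def)
    define c where "c = (\<Sum>i<p. \<Sum>j<p. \<bar>C $$ (i, j)\<bar>) + 1"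
    have c: "0 < c" by (auto simp: c_def intro!: add_nonneg_pos sum_nonneg)
    have inv: "nrm v \<le> c * quad_form p B v" for v
    proof -
      define u where "u i = (\<Sum>l<p. C $$ (i, l) * v l)" for i
      have Bu: "(\<Sum>j<p. B $$ (i, j) * u j) = v i" if i: "i < p" for i
      proof -
        have "(\<Sum>j<p. B $$ (i, j) * u j) = (\<Sum>l<p. (\<Sum>j<p. B $$ (i, j) * C $$ (j, l)) * v l)"
          unfolding u_def sum_distrib_left sum_distrib_right by (subst sum.swap) (simp add: mult_ac)
        also have "\<dots> = (\<Sum>l<p. (B * C) $$ (i, l) * v l)"
          using B C(1) i by (intro sum.cong refl) (simp add: scalar_prod_def atLeast0LessThan)
        also have "\<dots> = v i" using C i by (simp add: if_distrib[of "\<lambda>x. x * _"] cong: if_cong)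
        finally show ?thesis .
      qed
      have bil: "bilin_form p B w u = (\<Sum>i<p. w i * v i)" for w
        unfolding bilin_form_def using Bu by (simp add: sum_distrib_left[symmetric] mult.assoc)
      have "quad_form p B u = bilin_form p C v v"
        unfolding quad_form_eq_bilin bil by (simp add: bilin_form_def u_def sum_distrib_left mult_ac)
      also have "\<dots> \<le> c * nrm v"
        using Kbd[of C v] nrm_nn[of v] by (simp add: c_def algebra_simps)
      finally have 1: "quad_form p B u \<le> c * nrm v" .
      have "(nrm v)\<^sup>2 \<le> quad_form p B v * quad_form p B u"
        using bilin_form_Cauchy_Schwarz[OF B B_sym B_psd, of v u] by (simp add: bil nrm_def power2_eq_square)
      also have "\<dots> \<le> quad_form p B v * (c * nrm v)" by (intro mult_left_mono 1 B_psd)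
      finally have "nrm v * nrm v \<le> (c * quad_form p B v) * nrm v" by (simp add: power2_eq_square mult_ac)
      then show ?thesis
        using nrm_nn[of v] B_psd[of v] c by (cases "nrm v = 0") auto
    qed
    have "\<mu> < \<mu> + 1 / c" using c by simp
    then obtain x where x: "x \<in> S" "x < \<mu> + 1 / c"
      using cInf_less_iff[OF S_ne S_bdd] unfolding \<mu>_def by blast
    then obtain v where "nrm v = 1" "x = quad_form p A v" by (auto simp: S_def)
    then show False using inv[of v] x c by (simp add: B_quad field_simps)
  qed
  then have "\<mu> \<in> spectrum A" using eigenvalue_det[OF A(1)] by (simp add: spectrum_def B_def)
  then show ?thesis using low by (auto simp: nrm_def)
qed

lemma
  assumes p: "0 < p" and A: "pos_definite p A"
  shows lambda_min_pos: "0 < lambda_min A"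
    and lambda_min_le_quad_form: "lambda_min A * (\<Sum>j<p. (v j)\<^sup>2) \<le> quad_form p A v"
proof -
  have A': "A \<in> carrier_mat p p" "transpose_mat A = A" using A by (auto simp: pos_definite_def)
  obtain \<mu> where \<mu>: "\<mu> \<in> spectrum A" "\<And>v. \<mu> * (\<Sum>j<p. (v j)\<^sup>2) \<le> quad_form p A v"
    using Rayleigh_attained_at_eigenvalue[OF p A'] by blast
  have fin: "finite (spectrum A)" using card_finite_spectrum(1)[OF A'(1)] .
  have "lambda_min A \<le> \<mu>" unfolding lambda_min_def using fin \<mu>(1) by simp
  then have "lambda_min A * (\<Sum>j<p. (v j)\<^sup>2) \<le> \<mu> * (\<Sum>j<p. (v j)\<^sup>2)"
    by (intro mult_right_mono) (auto intro: sum_nonneg)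
  then show "lambda_min A * (\<Sum>j<p. (v j)\<^sup>2) \<le> quad_form p A v" using \<mu>(2)[of v] by linarith
  have "lambda_min A \<in> spectrum A" unfolding lambda_min_def using fin \<mu>(1) by (intro Min_in) auto
  then obtain x where x: "eigenvector A x (lambda_min A)" by (auto simp: spectrum_def eigenvalue_def)
  define w where "w j = vec_index x j" for j
  have xc: "x \<in> carrier_vec p" "x \<noteq> 0\<^sub>v p" "A *\<^sub>v x = lambda_min A \<cdot>\<^sub>v x"
    using x A' by (auto simp: eigenvector_def)
  have "(\<Sum>j<p. A $$ (i, j) * w j) = lambda_min A * w i" if i: "i < p" for i
  proof -
    have "(\<Sum>j<p. A $$ (i, j) * w j) = vec_index (A *\<^sub>v x) i"
      using A' xc(1) i by (simp add: scalar_prod_def atLeast0LessThan w_def)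
    then show ?thesis using xc i by (simp add: w_def)
  qed
  then have "(\<Sum>i<p. w i * (\<Sum>j<p. A $$ (i, j) * w j)) = (\<Sum>i<p. w i * (lambda_min A * w i))"
    by (intro sum.cong refl) auto
  moreover have "quad_form p A w = (\<Sum>i<p. w i * (\<Sum>j<p. A $$ (i, j) * w j))"
    by (simp add: quad_form_def sum_distrib_left mult.assoc)
  ultimately have q: "quad_form p A w = lambda_min A * (\<Sum>i<p. (w i)\<^sup>2)"
    by (simp add: sum_distrib_left power2_eq_square mult_ac)
  have "\<exists>j<p. w j \<noteq> 0"
    using xc by (metis w_def carrier_vecD eq_vecI index_zero_vec(1) index_zero_vec(2))
  then have "0 < quad_form p A w" using A by (auto simp: pos_definite_def)
  then show "0 < lambda_min A"
    unfolding q by (rule zero_less_mult_pos2) (use \<open>0 < quad_form p A w\<close> q sum_nonneg[of "{..<p}" "\<lambda>i. (w i)\<^sup>2"] in \<open>auto simp: zero_less_mult_iff\<close>)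
qed

section \<open>Moments of sub-Gaussian variables\<close>

text \<open>
  Variance proxy one is the normalization in which the design is used: \<open>Y\<close> is a projection \<open>\<langle>v, x\<rangle>\<close> with \<open>quad_form p Cov v \<le> 1\<close>,
  in particular a coordinate of \<open>x\<close>.
\<close>

locale unit_subgaussian = prob_space M for M :: "'a measure" +
  fixes Y :: "'a \<Rightarrow> real"
  assumes measurable_Y [measurable]: "Y \<in> borel_measurable M"
    and integrable_mgf: "\<And>t. integrable M (\<lambda>x. exp (t * Y x))"
    and mgf_le: "\<And>t. (\<integral>x. exp (t * Y x) \<partial>M) \<le> exp (t\<^sup>2 / 2)"
begin

lemma nn_mgf_le: "(\<integral>\<^sup>+x. ennreal (exp (t * Y x)) \<partial>M) \<le> ennreal (exp (t\<^sup>2 / 2))"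
  using mgf_le[of t] by (subst nn_integral_eq_integral[OF integrable_mgf]) (auto intro: ennreal_leI)

lemma
  shows integrable_exp_abs: "integrable M (\<lambda>x. exp (t * \<bar>Y x\<bar>))"
    and integral_exp_abs_le: "0 \<le> t \<Longrightarrow> (\<integral>x. exp (t * \<bar>Y x\<bar>) \<partial>M) \<le> 2 * exp (t\<^sup>2 / 2)"
proof -
  have le: "exp (t * \<bar>y\<bar>) \<le> exp (t * y) + exp (- t * y)" for y :: real
    by (cases "0 \<le> y") auto
  have int: "integrable M (\<lambda>x. exp (t * Y x) + exp (- t * Y x))"
    using integrable_mgf[of t] integrable_mgf[of "- t"] by (intro Bochner_Integration.integrable_add)
  show i: "integrable M (\<lambda>x. exp (t * \<bar>Y x\<bar>))"
    by (rule Bochner_Integration.integrable_bound[OF int])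
      (use le in \<open>auto intro: order.trans[OF _ abs_ge_self]\<close>)
  have "(\<integral>x. exp (t * \<bar>Y x\<bar>) \<partial>M) \<le> (\<integral>x. exp (t * Y x) + exp (- t * Y x) \<partial>M)"
    using le by (intro integral_mono i int)
  also have "\<dots> \<le> 2 * exp (t\<^sup>2 / 2)"
    using mgf_le[of t] mgf_le[of "- t"] integrable_mgf[of t] integrable_mgf[of "- t"] by simp
  finally show "(\<integral>x. exp (t * \<bar>Y x\<bar>) \<partial>M) \<le> 2 * exp (t\<^sup>2 / 2)" .
qed

lemma nn_exp_abs_le: "(\<integral>\<^sup>+x. ennreal (exp \<bar>Y x\<bar>) \<partial>M) \<le> ennreal (exp 2)"
proof -
  have "2 * exp (1 / 2) \<le> exp (1::real) * exp (1 / 2)"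
    using exp_ge_add_one_self[of "1::real"] by (intro mult_right_mono) auto
  also have "\<dots> \<le> exp 2" by (simp flip: exp_add)
  finally show ?thesis
    using integral_exp_abs_le[of 1] integrable_exp_abs[of 1]
    by (subst nn_integral_eq_integral) (auto intro!: ennreal_leI)
qed

text \<open>
  The bound comes from \<open>y\<^sup>4 \<le> (24 / t\<^sup>4) exp (t \<bar>y\<bar>)\<close> at \<open>t = 2\<close>, where the resulting estimate
  \<open>48 exp (t\<^sup>2 / 2) / t\<^sup>4\<close> of the fourth moment is smallest.
\<close>

lemma
  shows integrable_fourth_power: "integrable M (\<lambda>x. (Y x)^4)"
    and fourth_moment_le: "(\<integral>x. (Y x)^4 \<partial>M) \<le> 40"
proof -
  have le: "y^4 \<le> 3 / 2 * exp (2 * \<bar>y\<bar>)" for y :: real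
  proof -
    define u where "u = 2 * \<bar>y\<bar>"
    have u: "0 \<le> u" by (simp add: u_def)
    have f: "(fact 4 :: real) = 24" by (simp add: fact_numeral)
    have "(\<Sum>i<5. inverse (fact i) *\<^sub>R u^i) \<le> exp u"
      unfolding exp_def using u by (intro sum_le_suminf summable_exp_generic) auto
    moreover have "inverse (fact 4) *\<^sub>R u^4 \<le> (\<Sum>i<5. inverse (fact i) *\<^sub>R u^i)"
      using u by (intro member_le_sum) auto
    ultimately have "u^4 / 24 \<le> exp u"
      unfolding f real_scaleR_def divide_inverse by (simp only: mult.commute)
    moreover have "u^4 = 16 * y^4" by (simp add: u_def power_mult_distrib)
    ultimately show ?thesis by (simp add: u_def)
  qed
  have int: "integrable M (\<lambda>x. 3 / 2 * exp (2 * \<bar>Y x\<bar>))"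
    using integrable_exp_abs[of 2] by simp
  show i: "integrable M (\<lambda>x. (Y x)^4)"
    by (rule Bochner_Integration.integrable_bound[OF int])
      (use le in \<open>auto intro: order.trans[OF _ abs_ge_self]\<close>)
  have "(\<integral>x. (Y x)^4 \<partial>M) \<le> (\<integral>x. 3 / 2 * exp (2 * \<bar>Y x\<bar>) \<partial>M)"
    using le by (intro integral_mono i int)
  also have "\<dots> \<le> 3 * exp (1 + 1)" using integral_exp_abs_le[of 2] integrable_exp_abs[of 2] by simp
  also have "\<dots> \<le> 3 * (3 * 3)" unfolding exp_add
    by (intro mult_left_mono mult_mono exp_le) auto
  finally show "(\<integral>x. (Y x)^4 \<partial>M) \<le> 40" by simp
qed

lemma integrable_square: "integrable M (\<lambda>x. (Y x)\<^sup>2)"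
proof -
  have int: "integrable M (\<lambda>x. 1 + (Y x)^4)" using integrable_fourth_power by simp
  have le: "y\<^sup>2 \<le> 1 + y^4" for y :: real
    using zero_le_power2[of "y\<^sup>2 - 1/2"] by (simp add: power2_diff power_divide)
  show ?thesis
    by (rule Bochner_Integration.integrable_bound[OF int])
      (use le in \<open>auto intro: order.trans[OF _ abs_ge_self]\<close>)
qed

text \<open>
  This is where a variance bounded below is used. The elementary inequality \<open>\<bar>y\<bar> \<ge> y\<^sup>2 / 4 - y\<^sup>4 / 320\<close>
  turns the second and fourth moments into a lower bound on the first absolute moment, and
  \<open>exp (- u) \<le> 1 - u + u\<^sup>2 / 2\<close> turns that into an exponential bound.
\<close>

lemma exp_neg_abs_le:
  assumes var: "(\<integral>x. (Y x)\<^sup>2 \<partial>M) = 1"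
  shows "(\<integral>\<^sup>+x. ennreal (exp (- \<bar>Y x\<bar> / 8)) \<partial>M) \<le> ennreal (exp (- 1 / 128))"
proof -
  have le: "exp (- \<bar>y\<bar> / 8) \<le> 1 - 3 / 128 * y\<^sup>2 + y^4 / 2560" for y :: real
  proof -
    define a where "a = \<bar>y\<bar>"
    have a: "0 \<le> a" by (simp add: a_def)
    \<comment> \<open>The polynomial \<open>(a - c)\<^sup>2 (a + 2c) = a\<^sup>3 - 3 c\<^sup>2 a + 2 c\<^sup>3\<close> with \<open>3 c\<^sup>2\<close> slightly above \<open>80\<close>.\<close>
    have "0 \<le> (a - 26/5)\<^sup>2 * (a + 52/5)" using a by simp
    also have "\<dots> = a^3 - 2028 / 25 * a + 35152 / 125"
      by (simp add: power2_eq_square power3_eq_cube field_simps)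
    finally have "0 \<le> a^3 - 80 * a + 320" using a by linarith
    then have "0 \<le> a * (a^3 - 80 * a + 320)" using a by (rule mult_nonneg_nonneg[rotated])
    also have "\<dots> = a^4 - 80 * a\<^sup>2 + 320 * a"
      by (simp add: power2_eq_square power3_eq_cube power4_eq_xxxx algebra_simps)
    finally have abs: "a\<^sup>2 / 4 - a^4 / 320 \<le> a" by simp
    define u where "u = a / 8"
    have u: "0 \<le> u" using a by (simp add: u_def)
    have "1 * 1 \<le> (1 - u + u\<^sup>2 / 2) * (1 + u + u\<^sup>2 / 2)"
      using u by (simp add: algebra_simps power2_eq_square)
    also have "\<dots> \<le> (1 - u + u\<^sup>2 / 2) * exp u"
    proof (intro mult_left_mono exp_lower_Taylor_quadratic u)
      have "0 \<le> ((1 - u)\<^sup>2 + 1) / 2" by simp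
      then show "0 \<le> 1 - u + u\<^sup>2 / 2" by (simp add: power2_diff field_simps)
    qed
    finally have "exp (- u) \<le> 1 - u + u\<^sup>2 / 2" by (simp add: exp_minus field_simps)
    also have "\<dots> \<le> 1 - (a\<^sup>2 / 4 - a^4 / 320) / 8 + a\<^sup>2 / 128"
      using abs by (simp add: u_def power_divide)
    finally show ?thesis by (simp add: u_def a_def field_simps)
  qed
  have i1: "integrable M (\<lambda>x. exp (- \<bar>Y x\<bar> / 8))"
    using integrable_exp_abs[of "- 1 / 8"] by simp
  have i2: "integrable M (\<lambda>x. 1 - 3 / 128 * (Y x)\<^sup>2 + (Y x)^4 / 2560)"
    using integrable_square integrable_fourth_power by simp
  have "(\<integral>x. exp (- \<bar>Y x\<bar> / 8) \<partial>M) \<le> (\<integral>x. 1 - 3 / 128 * (Y x)\<^sup>2 + (Y x)^4 / 2560 \<partial>M)"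
    using le by (intro integral_mono i1 i2)
  also have "\<dots> = 1 - 3 / 128 + (\<integral>x. (Y x)^4 \<partial>M) / 2560"
    using integrable_square integrable_fourth_power var by (simp add: prob_space)
  also have "\<dots> \<le> 1 + (- 1 / 128)" using fourth_moment_le by simp
  also have "\<dots> \<le> exp (- 1 / 128)" by (rule exp_ge_add_one_self)
  finally show ?thesis
    by (subst nn_integral_eq_integral[OF i1]) (auto intro: ennreal_leI)
qed

text \<open>
  Gaussian linearization: \<open>exp (y\<^sup>2 / 4)\<close> is the mean of \<open>exp (g y / sqrt 2)\<close> for a standard normal \<open>g\<close>. After exchanging the
  two integrations the moment generating function of \<open>Y\<close> can be used for each fixed \<open>g\<close>; the remaining
  Gaussian integral is \<open>sqrt 2\<close>.
\<close>

lemma nn_exp_square_le: "(\<integral>\<^sup>+x. ennreal (exp ((Y x)\<^sup>2 / 4)) \<partial>M) \<le> ennreal 2"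
proof -
  interpret P: pair_sigma_finite M "lborel :: real measure" by standard
  define \<phi> where "\<phi> = normal_density 0 1"
  have [measurable]: "\<phi> \<in> borel_measurable borel" by (simp add: \<phi>_def)
  have \<phi>_nn: "0 \<le> \<phi> g" for g by (simp add: \<phi>_def)
  have shift: "ennreal (exp (y\<^sup>2 / 4)) = (\<integral>\<^sup>+g. ennreal (\<phi> g * exp (g / sqrt 2 * y)) \<partial>lborel)" for y :: real
  proof -
    have eq: "\<phi> g * exp (g / sqrt 2 * y) = exp (y\<^sup>2 / 4) * normal_density (y / sqrt 2) 1 g" for g
      by (simp add: \<phi>_def normal_density_def exp_add[symmetric] power2_diff power_divide field_simps)
    have "(\<integral>\<^sup>+g. ennreal (normal_density (y / sqrt 2) 1 g) \<partial>lborel) = 1"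
      using integral_normal_density[of 1 "y / sqrt 2"] integrable_normal_density[of 1 "y / sqrt 2"]
      by (subst nn_integral_eq_integral) auto
    then show ?thesis
      unfolding eq by (simp add: ennreal_mult' nn_integral_cmult)
  qed
  have "(\<integral>\<^sup>+x. ennreal (exp ((Y x)\<^sup>2 / 4)) \<partial>M)
      = (\<integral>\<^sup>+x. \<integral>\<^sup>+g. ennreal (\<phi> g * exp (g / sqrt 2 * Y x)) \<partial>lborel \<partial>M)"
    by (simp add: shift)
  also have "\<dots> = (\<integral>\<^sup>+g. \<integral>\<^sup>+x. ennreal (\<phi> g * exp (g / sqrt 2 * Y x)) \<partial>M \<partial>lborel)"
    by (rule P.Fubini'[symmetric]) measurable
  also have "\<dots> \<le> (\<integral>\<^sup>+g. ennreal (sqrt 2 * normal_density 0 (sqrt 2) g) \<partial>lborel)"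
  proof (intro nn_integral_mono)
    fix g :: real
    have "(\<integral>\<^sup>+x. ennreal (\<phi> g * exp (g / sqrt 2 * Y x)) \<partial>M)
        = ennreal (\<phi> g) * (\<integral>\<^sup>+x. ennreal (exp (g / sqrt 2 * Y x)) \<partial>M)"
      using \<phi>_nn by (simp add: ennreal_mult' nn_integral_cmult)
    also have "\<dots> \<le> ennreal (\<phi> g) * ennreal (exp ((g / sqrt 2)\<^sup>2 / 2))"
      by (intro mult_left_mono nn_mgf_le) auto
    also have "\<dots> = ennreal (\<phi> g * exp ((g / sqrt 2)\<^sup>2 / 2))"
      using \<phi>_nn by (simp add: ennreal_mult')
    also have "\<phi> g * exp ((g / sqrt 2)\<^sup>2 / 2) = sqrt 2 * normal_density 0 (sqrt 2) g"
    proof -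
      have "exp (- g\<^sup>2 / 2) * exp (g\<^sup>2 / 4) = exp (- g\<^sup>2 / 4)" by (simp flip: exp_add)
      then show ?thesis by (simp add: \<phi>_def normal_density_def power_divide real_sqrt_mult field_simps)
    qed
    finally show "(\<integral>\<^sup>+x. ennreal (\<phi> g * exp (g / sqrt 2 * Y x)) \<partial>M)
        \<le> ennreal (sqrt 2 * normal_density 0 (sqrt 2) g)" .
  qed
  also have "\<dots> = ennreal (sqrt 2)"
    using integral_normal_density[of "sqrt 2" 0] integrable_normal_density[of "sqrt 2" 0]
    by (subst nn_integral_eq_integral) auto
  also have "\<dots> \<le> ennreal 2"
    by (intro ennreal_leI real_le_lsqrt) auto
  finally show ?thesis .
qed

text \<open>
  Convexity of \<open>exp\<close> interpolates between the exponents \<open>0\<close> and \<open>Y\<^sup>2 / 4\<close>. The point is that the bound tends to one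
  linearly in \<open>\<theta>\<close>, as the moment generating function of a centred variable must.
\<close>

lemma nn_exp_small_square_le:
  assumes "0 \<le> \<theta>" "\<theta> \<le> 1"
  shows "(\<integral>\<^sup>+x. ennreal (exp (\<theta> * (Y x)\<^sup>2 / 4)) \<partial>M) \<le> ennreal (exp \<theta>)"
proof -
  have conv: "exp (\<theta> * u) \<le> (1 - \<theta>) + \<theta> * exp u" for u :: real
    using exp_convex[THEN convex_onD, of \<theta> 0 u] assms by simp
  have "(\<integral>\<^sup>+x. ennreal (exp (\<theta> * (Y x)\<^sup>2 / 4)) \<partial>M)
      \<le> (\<integral>\<^sup>+x. ennreal (1 - \<theta>) + ennreal \<theta> * ennreal (exp ((Y x)\<^sup>2 / 4)) \<partial>M)"
  proof (intro nn_integral_mono)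
    fix x
    have "ennreal (exp (\<theta> * (Y x)\<^sup>2 / 4)) \<le> ennreal ((1 - \<theta>) + \<theta> * exp ((Y x)\<^sup>2 / 4))"
      using conv[of "(Y x)\<^sup>2 / 4"] by (intro ennreal_leI) simp
    then show "ennreal (exp (\<theta> * (Y x)\<^sup>2 / 4)) \<le> ennreal (1 - \<theta>) + ennreal \<theta> * ennreal (exp ((Y x)\<^sup>2 / 4))"
      using assms by (simp add: ennreal_plus ennreal_mult')
  qed
  also have "\<dots> = ennreal (1 - \<theta>) + ennreal \<theta> * (\<integral>\<^sup>+x. ennreal (exp ((Y x)\<^sup>2 / 4)) \<partial>M)"
    by (simp add: nn_integral_add nn_integral_cmult emeasure_space_1)
  also have "\<dots> \<le> ennreal (1 - \<theta>) + ennreal \<theta> * ennreal 2"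
    by (intro add_left_mono mult_left_mono nn_exp_square_le) auto
  also have "\<dots> = ennreal (1 + \<theta>)"
    using assms by (subst ennreal_mult'[symmetric], simp, subst ennreal_plus[symmetric]) auto
  also have "\<dots> \<le> ennreal (exp \<theta>)" by (intro ennreal_leI exp_ge_add_one_self)
  finally show ?thesis .
qed

end

section \<open>Chernoff bounds for independent samples\<close>

lemma nn_integral_exp_sum_iid_le:
  fixes f :: "'a \<Rightarrow> real"
  assumes N: "prob_space N" and f [measurable]: "f \<in> borel_measurable N"
    and mgf: "(\<integral>\<^sup>+z. ennreal (exp (f z)) \<partial>N) \<le> ennreal (exp c)"
  shows "(\<integral>\<^sup>+S. ennreal (exp (\<Sum>i<n. f (S i))) \<partial>PiM {..<n} (\<lambda>_. N)) \<le> ennreal (exp (real n * c))"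
proof -
  interpret prob_space N by fact
  interpret product_sigma_finite "\<lambda>_ :: nat. N" by standard
  have "(\<integral>\<^sup>+S. ennreal (exp (\<Sum>i<n. f (S i))) \<partial>PiM {..<n} (\<lambda>_. N))
      = (\<integral>\<^sup>+S. (\<Prod>i<n. ennreal (exp (f (S i)))) \<partial>PiM {..<n} (\<lambda>_. N))"
    by (simp add: exp_sum prod_ennreal)
  also have "\<dots> = (\<Prod>i<n. \<integral>\<^sup>+z. ennreal (exp (f z)) \<partial>N)"
    by (rule product_nn_integral_prod) auto
  also have "\<dots> \<le> (\<Prod>i<n. ennreal (exp c))"
    using mgf by (induction n) (auto intro!: mult_mono)
  also have "\<dots> = ennreal (exp (real n * c))"
    by (simp add: exp_of_nat_mult ennreal_power)
  finally show ?thesis .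
qed

lemma Chernoff_iid:
  fixes f :: "'a \<Rightarrow> real"
  assumes N: "prob_space N" and f [measurable]: "f \<in> borel_measurable N"
    and mgf: "(\<integral>\<^sup>+z. ennreal (exp (f z)) \<partial>N) \<le> ennreal (exp c)"
  shows "\<P>(S in PiM {..<n} (\<lambda>_. N). t \<le> (\<Sum>i<n. f (S i))) \<le> exp (real n * c - t)"
proof -
  let ?P = "PiM {..<n} (\<lambda>_. N)"
  interpret P: prob_space ?P using N by (intro prob_space_PiM)
  have "emeasure ?P {S \<in> space ?P. t \<le> (\<Sum>i<n. f (S i))}
      = (\<integral>\<^sup>+S. indicator {S \<in> space ?P. t \<le> (\<Sum>i<n. f (S i))} S \<partial>?P)"
    by (intro nn_integral_indicator[symmetric]) measurable
  also have "\<dots> \<le> (\<integral>\<^sup>+S. ennreal (exp (- t)) * ennreal (exp (\<Sum>i<n. f (S i))) \<partial>?P)"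
    by (intro nn_integral_mono)
      (auto simp: indicator_def ennreal_mult'[symmetric] exp_add[symmetric] simp flip: ennreal_1 intro!: ennreal_leI)
  also have "\<dots> = ennreal (exp (- t)) * (\<integral>\<^sup>+S. ennreal (exp (\<Sum>i<n. f (S i))) \<partial>?P)"
    by (intro nn_integral_cmult) measurable
  also have "\<dots> \<le> ennreal (exp (- t)) * ennreal (exp (real n * c))"
    by (intro mult_left_mono nn_integral_exp_sum_iid_le assms) auto
  also have "\<dots> = ennreal (exp (real n * c - t))"
    by (simp add: ennreal_mult'[symmetric] exp_add[symmetric])
  finally show ?thesis by (simp add: P.emeasure_eq_measure)
qed

section \<open>The regression model\<close>

lemma measurable_dot_const [measurable (raw)]:
  assumes [measurable]: "g \<in> measurable M (borel_vec p)"
  shows "(\<lambda>x. dot p v (g x)) \<in> borel_measurable M"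
  unfolding dot_def by measurable

lemma dot_scale_left: "dot p (\<lambda>j. c * v j) x = c * dot p v x"
  by (simp add: dot_def sum_distrib_left mult_ac)

lemma dot_diff_left: "dot p (\<lambda>j. v j - w j) x = dot p v x - dot p w x"
  by (simp add: dot_def sum_subtractf algebra_simps)

text \<open>
  Bounds the variance of the noise by exponential moments in a way that is sharp for vanishing noise: it gives
  variance zero for \<open>\<sigma> = 0\<close>.
\<close>

lemma exp_square_le_exp_sum: "e\<^sup>2 \<le> 4 * (exp e + exp (- e) - 2)" for e :: real
proof -
  define u where "u = \<bar>e\<bar> / 2"
  have u: "0 \<le> u" by (simp add: u_def)
  have "exp (- u) \<le> 1" using u by simp
  then have "u \<le> exp u - exp (- u)"
    using exp_ge_add_one_self[of u] by linarith
  then have "u\<^sup>2 \<le> (exp u - exp (- u))\<^sup>2"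
    using u by (intro power_mono)
  also have "\<dots> = exp (u + u) + exp (- u + - u) - 2 * exp (u + - u)"
    unfolding exp_add by (simp only: power2_eq_square algebra_simps)
  also have "u + u = \<bar>e\<bar>" by (simp add: u_def)
  also have "- u + - u = - \<bar>e\<bar>" by (simp add: u_def)
  also have "exp \<bar>e\<bar> + exp (- \<bar>e\<bar>) - 2 * exp (u + - u) = exp e + exp (- e) - 2"
    by (cases "0 \<le> e") (simp_all add: abs_if)
  finally show ?thesis by (simp add: u_def power_divide)
qed

context sparse_regression begin

abbreviation "obs \<equiv> obs_law p wbar Dx De"
abbreviation "sample \<equiv> sample_law n p wbar Dx De"
definition "noise z = snd z - dot p wbar (fst z)"

lemma sets_Dx [measurable_cong]: "sets Dx = sets (borel_vec p)" and sets_De [measurable_cong]: "sets De = sets borel"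
  using design_sets noise_sets by auto

sublocale X: prob_space Dx by (rule design_prob)
sublocale E: prob_space De by (rule noise_prob)
sublocale XE: pair_prob_space Dx De by standard

lemma measurable_obs_map [measurable]:
  "(\<lambda>(x, e). (x, dot p wbar x + e)) \<in> Dx \<Otimes>\<^sub>M De \<rightarrow>\<^sub>M borel_vec p \<Otimes>\<^sub>M borel"
  by measurable

sublocale obs: prob_space obs
  unfolding obs_law_def by (rule XE.prob_space_distr) measurable

sublocale sample: prob_space sample
  unfolding sample_law_def by (intro prob_space_PiM obs.prob_space_axioms)

lemma sets_obs [measurable_cong]: "sets obs = sets (borel_vec p \<Otimes>\<^sub>M borel)"
  by (simp add: obs_law_def)

lemma sets_sample [measurable_cong]: "sets sample = sets (PiM {..<n} (\<lambda>_. borel_vec p \<Otimes>\<^sub>M borel))"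
  unfolding sample_law_def by (intro sets_PiM_cong refl sets_obs)

lemma measurable_noise [measurable]: "noise \<in> borel_measurable (borel_vec p \<Otimes>\<^sub>M borel)"
  unfolding noise_def by measurable

lemma nn_integral_obs:
  assumes [measurable]: "f \<in> borel_measurable (borel_vec p \<Otimes>\<^sub>M borel)"
  shows "(\<integral>\<^sup>+z. f z \<partial>obs) = (\<integral>\<^sup>+x. \<integral>\<^sup>+e. f (x, dot p wbar x + e) \<partial>De \<partial>Dx)"
proof -
  have "(\<integral>\<^sup>+z. f z \<partial>obs) = (\<integral>\<^sup>+y. f (case y of (x, e) \<Rightarrow> (x, dot p wbar x + e)) \<partial>(Dx \<Otimes>\<^sub>M De))"
    unfolding obs_law_def by (rule nn_integral_distr) measurable
  also have "\<dots> = (\<integral>\<^sup>+x. \<integral>\<^sup>+e. f (x, dot p wbar x + e) \<partial>De \<partial>Dx)"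
    by (subst E.nn_integral_fst[symmetric]) (simp_all add: split_beta')
  finally show ?thesis .
qed

lemma nn_integral_obs_design:
  assumes [measurable]: "g \<in> borel_measurable (borel_vec p)"
  shows "(\<integral>\<^sup>+z. g (fst z) \<partial>obs) = (\<integral>\<^sup>+x. g x \<partial>Dx)"
  by (subst nn_integral_obs) (auto simp: E.emeasure_space_1)

lemma
  shows integrable_dot_product: "integrable Dx (\<lambda>x. dot p u x * dot p v x)"
    and integral_dot_product: "(\<integral>x. dot p u x * dot p v x \<partial>Dx) = bilin_form p Cov u v"
proof -
  have eq: "dot p u x * dot p v x = (\<Sum>i<p. \<Sum>j<p. u i * v j * (x i * x j))" for x
    by (simp add: dot_def sum_product mult_ac)
  have int: "integrable Dx (\<lambda>x. x i * x j)" "(\<integral>x. x i * x j \<partial>Dx) = Cov $$ (i, j)" if "i < p" "j < p" for i j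
    using design_subgaussian that by (auto simp: subgaussian_vec_def)
  show "integrable Dx (\<lambda>x. dot p u x * dot p v x)"
    unfolding eq by (intro Bochner_Integration.integrable_sum integrable_mult_right int) auto
  have "(\<integral>x. dot p u x * dot p v x \<partial>Dx) = (\<Sum>i<p. \<integral>x. (\<Sum>j<p. u i * v j * (x i * x j)) \<partial>Dx)"
    unfolding eq
    by (intro Bochner_Integration.integral_sum Bochner_Integration.integrable_sum integrable_mult_right int) auto
  also have "\<dots> = (\<Sum>i<p. \<Sum>j<p. \<integral>x. u i * v j * (x i * x j) \<partial>Dx)"
    by (intro sum.cong refl Bochner_Integration.integral_sum integrable_mult_right int) auto
  also have "\<dots> = bilin_form p Cov u v"
    unfolding bilin_form_def by (intro sum.cong refl) (simp add: int)
  finally show "(\<integral>x. dot p u x * dot p v x \<partial>Dx) = bilin_form p Cov u v" .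
qed

lemma quad_form_Cov_nonneg: "0 \<le> quad_form p Cov v"
  using integral_dot_product[of v v] Bochner_Integration.integral_nonneg[of Dx "\<lambda>x. dot p v x * dot p v x"]
  by (simp add: quad_form_eq_bilin)

lemma Cov_symmetric: "Cov \<in> carrier_mat p p" "transpose_mat Cov = Cov"
  using cov_pos_definite by (auto simp: pos_definite_def)

lemma unit_subgaussian_dot:
  assumes "quad_form p Cov v \<le> 1"
  shows "unit_subgaussian Dx (\<lambda>x. dot p v x)"
proof
  show "(\<lambda>x. dot p v x) \<in> borel_measurable Dx" by measurable
  fix t :: real
  have v: "integrable Dx (\<lambda>x. exp (dot p (\<lambda>j. t * v j) x))"
    "(\<integral>x. exp (dot p (\<lambda>j. t * v j) x) \<partial>Dx) \<le> exp (quad_form p Cov (\<lambda>j. t * v j) / 2)"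
    using design_subgaussian by (auto simp: subgaussian_vec_def)
  show "integrable Dx (\<lambda>x. exp (t * dot p v x))" using v(1) by (simp add: dot_scale_left)
  have "t\<^sup>2 * quad_form p Cov v \<le> t\<^sup>2 * 1" using assms by (intro mult_left_mono) auto
  then show "(\<integral>x. exp (t * dot p v x) \<partial>Dx) \<le> exp (t\<^sup>2 / 2)"
    using v(2) unfolding quad_form_scale dot_scale_left by (elim order.trans) simp
qed

lemma unit_subgaussian_coord:
  assumes "j < p"
  shows "unit_subgaussian Dx (\<lambda>x. x j)"
proof -
  define e where "e = (\<lambda>i. if i = j then 1 else (0::real))"
  have dot: "dot p e x = x j" for x
    using assms by (simp add: dot_def e_def if_distrib[of "\<lambda>y. y * _"] cong: if_cong)
  have "quad_form p Cov e = Cov $$ (j, j)"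
    using integral_dot_product[of e e] assms design_subgaussian
    by (simp add: quad_form_eq_bilin dot subgaussian_vec_def)
  then show ?thesis
    using unit_subgaussian_dot[of e] cov_diag[OF assms] by (simp add: dot)
qed

lemma mgf_neg_abs_dot:
  assumes "0 < quad_form p Cov v"
  shows "(\<integral>\<^sup>+z. ennreal (exp (- \<bar>dot p v (fst z)\<bar> / (8 * sqrt (quad_form p Cov v)))) \<partial>obs)
    \<le> ennreal (exp (- 1 / 128))"
proof -
  define u where "u = (\<lambda>j. 1 / sqrt (quad_form p Cov v) * v j)"
  have q: "quad_form p Cov u = 1"
    unfolding u_def quad_form_scale using assms by (simp add: power_divide)
  interpret unit_subgaussian Dx "\<lambda>x. dot p u x"
    using q by (intro unit_subgaussian_dot) simp
  have var: "(\<integral>x. (dot p u x)\<^sup>2 \<partial>Dx) = 1"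
    using integral_dot_product[of u u] q by (simp add: quad_form_eq_bilin power2_eq_square)
  have eq: "- \<bar>dot p v x\<bar> / (8 * sqrt (quad_form p Cov v)) = - \<bar>dot p u x\<bar> / 8" for x
    using assms unfolding u_def dot_scale_left by (simp add: abs_mult)
  have "(\<integral>\<^sup>+z. ennreal (exp (- \<bar>dot p u (fst z)\<bar> / 8)) \<partial>obs)
      = (\<integral>\<^sup>+x. ennreal (exp (- \<bar>dot p u x\<bar> / 8)) \<partial>Dx)"
    by (rule nn_integral_obs_design) measurable
  then show ?thesis unfolding eq using exp_neg_abs_le[OF var] by simp
qed

lemma mgf_abs_coord:
  assumes "j < p"
  shows "(\<integral>\<^sup>+z. ennreal (exp \<bar>fst z j\<bar>) \<partial>obs) \<le> ennreal (exp 2)"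
proof -
  interpret unit_subgaussian Dx "\<lambda>x. x j" by (rule unit_subgaussian_coord[OF assms])
  have "(\<integral>\<^sup>+z. ennreal (exp \<bar>fst z j\<bar>) \<partial>obs) = (\<integral>\<^sup>+x. ennreal (exp \<bar>x j\<bar>) \<partial>Dx)"
    using assms by (intro nn_integral_obs_design) measurable
  then show ?thesis using nn_exp_abs_le by simp
qed

text \<open>
  Integrating over the noise first leaves \<open>exp (\<sigma>\<^sup>2 s\<^sup>2 x\<^sub>j\<^sup>2 / 2)\<close>, a small multiple of \<open>x\<^sub>j\<^sup>2\<close> in the exponent as long as \<open>s\<close> is
  at most of order \<open>1 / \<sigma>\<close>. The product of two sub-Gaussian variables is only sub-exponential, so \<open>s\<close> cannot be arbitrary.
\<close>

lemma mgf_noise_coord: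
  assumes j: "j < p" and s: "2 * \<sigma>\<^sup>2 * s\<^sup>2 \<le> 1"
  shows "(\<integral>\<^sup>+z. ennreal (exp (s * (fst z j * noise z))) \<partial>obs) \<le> ennreal (exp (2 * \<sigma>\<^sup>2 * s\<^sup>2))"
proof -
  interpret unit_subgaussian Dx "\<lambda>x. x j" by (rule unit_subgaussian_coord[OF j])
  have "(\<integral>\<^sup>+z. ennreal (exp (s * (fst z j * noise z))) \<partial>obs)
      = (\<integral>\<^sup>+x. \<integral>\<^sup>+e. ennreal (exp ((s * x j) * e)) \<partial>De \<partial>Dx)"
    using j by (subst nn_integral_obs) (auto simp: noise_def mult_ac)
  also have "\<dots> \<le> (\<integral>\<^sup>+x. ennreal (exp ((2 * \<sigma>\<^sup>2 * s\<^sup>2) * (x j)\<^sup>2 / 4)) \<partial>Dx)"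
  proof (intro nn_integral_mono)
    fix x
    have "integrable De (\<lambda>e. exp (t * e))" "(\<integral>e. exp (t * e) \<partial>De) \<le> exp (\<sigma>\<^sup>2 * t\<^sup>2 / 2)" for t
      using noise_subgaussian by (auto simp: subgaussian_def)
    note m = this[of "s * x j"]
    have "(\<integral>\<^sup>+e. ennreal (exp ((s * x j) * e)) \<partial>De) \<le> ennreal (exp (\<sigma>\<^sup>2 * (s * x j)\<^sup>2 / 2))"
      using m(2) by (subst nn_integral_eq_integral[OF m(1)]) (auto intro: ennreal_leI)
    also have "\<sigma>\<^sup>2 * (s * x j)\<^sup>2 / 2 = (2 * \<sigma>\<^sup>2 * s\<^sup>2) * (x j)\<^sup>2 / 4"
      by (simp add: power_mult_distrib)
    finally show "(\<integral>\<^sup>+e. ennreal (exp ((s * x j) * e)) \<partial>De) \<le> ennreal (exp ((2 * \<sigma>\<^sup>2 * s\<^sup>2) * (x j)\<^sup>2 / 4))" .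
  qed
  also have "\<dots> \<le> ennreal (exp (2 * \<sigma>\<^sup>2 * s\<^sup>2))"
    using s by (intro nn_exp_small_square_le) auto
  finally show ?thesis .
qed

end

section \<open>Restricted eigenvalues by rounding to a grid\<close>

text \<open>
  The entries outside \<open>{..<p}\<close> are fixed to zero in order that the set be finite.
\<close>

definition sparse_grid :: "nat \<Rightarrow> nat \<Rightarrow> nat \<Rightarrow> (nat \<Rightarrow> real) set" where
  "sparse_grid p d m = {z. (\<forall>j. z j \<in> real_of_int ` {- int m..int m}) \<and> (\<forall>j\<ge>p. z j = 0) \<and> l0_norm p z \<le> d}"

text \<open>
  A sparse grid vector is determined by a list of \<open>d\<close> pairs of an index and a value.
\<close>

lemma
  assumes p: "0 < p"
  shows finite_sparse_grid: "finite (sparse_grid p d m)"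
    and card_sparse_grid_le: "card (sparse_grid p d m) \<le> (p * (2 * m + 1)) ^ d"
proof -
  define A where "A = {..<p} \<times> {- int m..int m}"
  define L where "L = {xs :: (nat \<times> int) list. set xs \<subseteq> A \<and> length xs = d}"
  define g where "g xs j = (case map_of xs j of None \<Rightarrow> 0 | Some a \<Rightarrow> real_of_int a)" for xs :: "(nat \<times> int) list" and j
  have A: "finite A" "card A = p * (2 * m + 1)" by (auto simp: A_def nat_add_distrib nat_mult_distrib)
  have L: "finite L" "card L = (p * (2 * m + 1)) ^ d"
    using finite_lists_length_eq[OF A(1)] card_lists_length_eq[OF A(1)] by (auto simp: L_def A(2))
  have sub: "sparse_grid p d m \<subseteq> g ` L"
  proof
    fix z assume z: "z \<in> sparse_grid p d m"
    define T where "T = {j \<in> {..<p}. z j \<noteq> 0}"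
    have T: "finite T" "card T \<le> d" using z by (auto simp: T_def sparse_grid_def l0_norm_def)
    \<comment> \<open>The support is padded to length \<open>d\<close> with copies of the index \<open>0\<close>, together with its true value, which may be zero.\<close>
    define js where "js = sorted_list_of_set T @ replicate (d - card T) 0"
    define xs where "xs = map (\<lambda>j. (j, \<lfloor>z j\<rfloor>)) js"
    have floor: "real_of_int \<lfloor>z j\<rfloor> = z j" "\<lfloor>z j\<rfloor> \<in> {- int m..int m}" for j
    proof -
      have "z j \<in> real_of_int ` {- int m..int m}" using z by (simp add: sparse_grid_def)
      then show "real_of_int \<lfloor>z j\<rfloor> = z j" "\<lfloor>z j\<rfloor> \<in> {- int m..int m}" by auto
    qed
    have set_js: "T \<subseteq> set js" "set js \<subseteq> {..<p}" using T p by (auto simp: js_def T_def)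
    have "length xs = d" using T by (simp add: xs_def js_def)
    moreover have "set xs \<subseteq> A" using set_js(2) floor(2) by (auto simp: xs_def A_def)
    ultimately have "xs \<in> L" by (simp add: L_def)
    moreover have "g xs = z"
    proof
      fix j
      have map: "map_of xs = (Some \<circ> (\<lambda>j. \<lfloor>z j\<rfloor>)) |` set js"
        unfolding xs_def by (rule map_of_map_restrict)
      show "g xs j = z j"
      proof (cases "j \<in> set js")
        case True
        then show ?thesis by (simp add: g_def map floor(1))
      next
        case False
        then have "j \<notin> T" using set_js by auto
        then have "z j = 0" using z by (cases "j < p") (auto simp: T_def sparse_grid_def)
        then show ?thesis using False by (simp add: g_def map)
      qed
    qed
    ultimately show "z \<in> g ` L" by auto
  qed
  show "finite (sparse_grid p d m)" using sub L(1) by (rule finite_subset[OF _ finite_imageI])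
  have "card (sparse_grid p d m) \<le> card (g ` L)" using sub L(1) by (intro card_mono) auto
  also have "\<dots> \<le> card L" using L(1) by (rule card_image_le)
  finally show "card (sparse_grid p d m) \<le> (p * (2 * m + 1)) ^ d" by (simp add: L(2))
qed

text \<open>
  Rounding towards minus infinity keeps zeros, so the rounded vector is as sparse as \<open>v\<close> and the
  rounding error in the \<open>l1\<close> norm is at most the sparsity.
\<close>

lemma floor_approximates_sparse:
  defines "z \<equiv> \<lambda>(v :: nat \<Rightarrow> real) p j. if j < p then real_of_int \<lfloor>v j\<rfloor> else 0"
  assumes v: "\<And>j. j < p \<Longrightarrow> \<bar>v j\<bar> \<le> real m" and sparse: "l0_norm p v \<le> d"
  shows "z v p \<in> sparse_grid p d m" and "(\<Sum>j<p. \<bar>v j - z v p j\<bar>) \<le> real d"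
proof -
  have sub: "{j \<in> {..<p}. z v p j \<noteq> 0} \<subseteq> {j \<in> {..<p}. v j \<noteq> 0}" by (auto simp: z_def)
  have "l0_norm p (z v p) \<le> d"
    using card_mono[OF _ sub] sparse by (simp add: l0_norm_def)
  moreover have "z v p j \<in> real_of_int ` {- int m..int m}" for j
  proof (cases "j < p")
    case True
    then have "- real m \<le> v j" "v j \<le> real m" using v[of j] by auto
    then have "\<lfloor>v j\<rfloor> \<in> {- int m..int m}" by (auto simp: le_floor_iff floor_le_iff)
    then show ?thesis using True by (auto simp: z_def)
  qed (auto simp: z_def)
  ultimately show "z v p \<in> sparse_grid p d m" by (auto simp: sparse_grid_def z_def)
  have "(\<Sum>j<p. \<bar>v j - z v p j\<bar>) \<le> (\<Sum>j<p. if v j \<noteq> 0 then 1 else 0)"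
  proof (intro sum_mono)
    fix j assume "j \<in> {..<p}"
    then show "\<bar>v j - z v p j\<bar> \<le> (if v j \<noteq> 0 then 1 else 0)"
      using real_of_int_floor_add_one_ge[of "v j"] of_int_floor_le[of "v j"]
      by (auto simp: z_def abs_le_iff algebra_simps)
  qed
  also have "\<dots> = real (l0_norm p v)"
    by (simp add: l0_norm_def sum.If_cases Int_def)
  finally show "(\<Sum>j<p. \<bar>v j - z v p j\<bar>) \<le> real d" using sparse by linarith
qed

lemma abs_le_L2_set:
  assumes "finite A" "j \<in> A"
  shows "\<bar>v j\<bar> \<le> L2_set v A"
proof -
  have "(v j)\<^sup>2 \<le> (\<Sum>i\<in>A. (v i)\<^sup>2)" using assms by (intro member_le_sum) auto
  then have "sqrt ((v j)\<^sup>2) \<le> L2_set v A" unfolding L2_set_def by (rule real_sqrt_le_mono)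
  then show ?thesis by simp
qed

context sparse_regression begin

lemma p_pos: "0 < p" using p_ge_2 by simp

lemma lambda_pos: "0 < lambda_min Cov"
  using lambda_min_pos[OF p_pos cov_pos_definite] .

lemma lambda_le_quad_form: "sqrt (lambda_min Cov) * L2_set v {..<p} \<le> sqrt (quad_form p Cov v)"
  using lambda_min_le_quad_form[OF p_pos cov_pos_definite, of v]
  unfolding L2_set_def by (simp flip: real_sqrt_mult)

lemma lambda_le_1: "lambda_min Cov \<le> 1"
proof -
  define e where "e = (\<lambda>i. if i = (0::nat) then 1 else (0::real))"
  have "quad_form p Cov e \<le> 1"
    using quad_form_l1_bound[OF Cov_symmetric quad_form_Cov_nonneg cov_diag, of e] p_pos
    by (simp add: e_def if_distrib[of abs] cong: if_cong)
  moreover have "(\<Sum>j<p. (e j)\<^sup>2) = 1"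
    using p_pos by (simp add: e_def if_distrib[of "\<lambda>x. x\<^sup>2"] cong: if_cong)
  ultimately show ?thesis
    using lambda_min_le_quad_form[OF p_pos cov_pos_definite, of e] by simp
qed

lemma sum_abs_dot_le:
  fixes X :: "nat \<Rightarrow> nat \<Rightarrow> real"
  assumes "\<And>j. j < p \<Longrightarrow> (\<Sum>i<n. \<bar>X i j\<bar>) \<le> B"
  shows "(\<Sum>i<n. \<bar>dot p w (X i)\<bar>) \<le> B * (\<Sum>j<p. \<bar>w j\<bar>)"
proof -
  have "(\<Sum>i<n. \<bar>dot p w (X i)\<bar>) \<le> (\<Sum>i<n. \<Sum>j<p. \<bar>w j\<bar> * \<bar>X i j\<bar>)"
    unfolding dot_def by (intro sum_mono order.trans[OF sum_abs]) (simp add: abs_mult)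
  also have "\<dots> = (\<Sum>j<p. \<bar>w j\<bar> * (\<Sum>i<n. \<bar>X i j\<bar>))"
    by (subst sum.swap) (simp add: sum_distrib_left)
  also have "\<dots> \<le> (\<Sum>j<p. \<bar>w j\<bar> * B)"
    using assms by (intro sum_mono mult_left_mono) auto
  finally show ?thesis by (simp add: sum_distrib_left mult.commute)
qed

text \<open>
  Deterministic passage from the grid to all sparse vectors. Both sides are homogeneous, so \<open>v\<close> may be
  scaled to Euclidean norm \<open>m\<close>. Rounding then costs at most \<open>d\<close> in \<open>sqrt Q\<close> and at most \<open>4 n d\<close> in the sum of absolute values,
  while \<open>sqrt Q\<close> itself is at least \<open>m sqrt (lambda_min Cov)\<close>. The constant \<open>258 = 64 (4 + 1/32)\<close> makes the loss at most half of the
  grid bound.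
\<close>

lemma restricted_eigenvalue_from_grid:
  fixes X :: "nat \<Rightarrow> nat \<Rightarrow> real"
  assumes col: "\<And>j. j < p \<Longrightarrow> (\<Sum>i<n. \<bar>X i j\<bar>) \<le> 4 * real n"
    and grid: "\<And>z. z \<in> sparse_grid p d m \<Longrightarrow> real n * sqrt (quad_form p Cov z) / 32 \<le> (\<Sum>i<n. \<bar>dot p z (X i)\<bar>)"
    and m: "0 < m" "258 * real d \<le> real m * sqrt (lambda_min Cov)"
    and sparse: "l0_norm p v \<le> d"
  shows "real n * sqrt (quad_form p Cov v) / 64 \<le> (\<Sum>i<n. \<bar>dot p v (X i)\<bar>)"
proof (cases "L2_set v {..<p} = 0")
  case True
  then have "\<forall>j<p. v j = 0" by (auto simp: L2_set_eq_0_iff)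
  then have "quad_form p Cov v = 0" by (simp add: quad_form_def)
  then show ?thesis by (simp add: sum_nonneg)
next
  case False
  define r where "r = L2_set v {..<p}"
  have r: "0 < r" using False L2_set_nonneg[of v "{..<p}"] unfolding r_def by linarith
  define c where "c = real m / r"
  have c: "0 < c" using r m by (simp add: c_def)
  define u where "u = (\<lambda>j. c * v j)"
  define z where "z = (\<lambda>j. if j < p then real_of_int \<lfloor>u j\<rfloor> else 0)"
  define e where "e = (\<lambda>j. u j - z j)"
  have u_le: "\<bar>u j\<bar> \<le> real m" if "j < p" for j
  proof -
    have "c * \<bar>v j\<bar> \<le> c * r"
      using abs_le_L2_set[of "{..<p}" j v] that c unfolding r_def by (intro mult_left_mono) auto
    then show ?thesis using c r by (simp add: u_def abs_mult c_def)
  qed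
  have u_sparse: "l0_norm p u \<le> d" using sparse c by (simp add: u_def l0_norm_def)
  have z: "z \<in> sparse_grid p d m" and e: "(\<Sum>j<p. \<bar>e j\<bar>) \<le> real d"
    using floor_approximates_sparse[of p u m d, OF u_le u_sparse] by (simp_all add: z_def e_def)
  have Qu: "sqrt (quad_form p Cov u) = c * sqrt (quad_form p Cov v)"
    unfolding u_def quad_form_scale using c by (simp add: real_sqrt_mult)
  have "sqrt (quad_form p Cov (\<lambda>j. z j + e j)) \<le> sqrt (quad_form p Cov z) + sqrt (quad_form p Cov e)"
    by (rule sqrt_quad_form_triangle[OF Cov_symmetric quad_form_Cov_nonneg])
  also have "sqrt (quad_form p Cov e) \<le> real d"
    using quad_form_l1_bound[OF Cov_symmetric quad_form_Cov_nonneg cov_diag, of e] e by linarith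
  finally have Qz: "c * sqrt (quad_form p Cov v) - real d \<le> sqrt (quad_form p Cov z)"
    by (simp add: e_def Qu)
  have "258 * real d \<le> real m * sqrt (lambda_min Cov)" by (rule m)
  also have "\<dots> = c * (sqrt (lambda_min Cov) * r)" using r by (simp add: c_def)
  also have "\<dots> \<le> c * sqrt (quad_form p Cov v)"
    using c lambda_le_quad_form[of v] by (simp add: r_def)
  finally have d: "258 * real d \<le> c * sqrt (quad_form p Cov v)" .
  have "c * (real n * sqrt (quad_form p Cov v) / 64)
      \<le> real n * ((c * sqrt (quad_form p Cov v) - real d) / 32 - 4 * real d)"
  proof -
    have rounding_slack: "y / 64 \<le> (y - a) / 32 - 4 * a" if "258 * a \<le> y" for a y :: real
      using that by (simp add: field_simps)
    have "c * sqrt (quad_form p Cov v) / 64 \<le> (c * sqrt (quad_form p Cov v) - real d) / 32 - 4 * real d"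
      using d by (rule rounding_slack)
    then have "real n * (c * sqrt (quad_form p Cov v) / 64)
        \<le> real n * ((c * sqrt (quad_form p Cov v) - real d) / 32 - 4 * real d)"
      by (intro mult_left_mono) auto
    then show ?thesis by (simp add: mult_ac)
  qed
  also have "\<dots> \<le> real n * sqrt (quad_form p Cov z) / 32 - 4 * real n * real d"
  proof -
    have "real n * (c * sqrt (quad_form p Cov v) - real d) \<le> real n * sqrt (quad_form p Cov z)"
      using Qz by (intro mult_left_mono) auto
    then show ?thesis by (simp add: algebra_simps)
  qed
  also have "\<dots> \<le> (\<Sum>i<n. \<bar>dot p z (X i)\<bar>) - (\<Sum>i<n. \<bar>dot p e (X i)\<bar>)"
  proof -
    have "(\<Sum>i<n. \<bar>dot p e (X i)\<bar>) \<le> 4 * real n * (\<Sum>j<p. \<bar>e j\<bar>)"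
      using col by (rule sum_abs_dot_le)
    also have "\<dots> \<le> 4 * real n * real d" using e by (intro mult_left_mono) auto
    finally show ?thesis using grid[OF z] by linarith
  qed
  also have "\<dots> \<le> (\<Sum>i<n. \<bar>dot p u (X i)\<bar>)"
    unfolding sum_subtractf[symmetric] e_def dot_diff_left by (intro sum_mono) linarith
  also have "\<dots> = c * (\<Sum>i<n. \<bar>dot p v (X i)\<bar>)"
    using c unfolding u_def dot_scale_left by (simp add: abs_mult sum_distrib_left)
  finally show ?thesis using c by (rule mult_left_le_imp_le)
qed

lemma prob_column_sum_large:
  assumes "j < p"
  shows "sample.prob {S \<in> space sample. 4 * real n \<le> (\<Sum>i<n. \<bar>fst (S i) j\<bar>)} \<le> exp (- 2 * real n)"
  using Chernoff_iid[OF obs.prob_space_axioms _ mgf_abs_coord[OF assms], of n "4 * real n"] assms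
  by (simp add: sample_law_def)

lemma prob_design_sum_small:
  assumes "0 < quad_form p Cov z"
  shows "sample.prob {S \<in> space sample. (\<Sum>i<n. \<bar>dot p z (fst (S i))\<bar>) \<le> real n * sqrt (quad_form p Cov z) / 32}
    \<le> exp (- real n / 256)"
proof -
  let ?q = "sqrt (quad_form p Cov z)"
  have q: "0 < ?q" using assms by simp
  have "{S \<in> space sample. (\<Sum>i<n. \<bar>dot p z (fst (S i))\<bar>) \<le> real n * ?q / 32}
      = {S \<in> space sample. - real n / 256 \<le> (\<Sum>i<n. - \<bar>dot p z (fst (S i))\<bar> / (8 * ?q))}"
    using q by (simp add: sum_negf sum_divide_distrib[symmetric] field_simps)
  then show ?thesis
    using Chernoff_iid[OF obs.prob_space_axioms _ mgf_neg_abs_dot[OF assms], of n "- real n / 256"]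
    by (simp add: sample_law_def)
qed

end

lemma half_le_ln:
  assumes "2 \<le> m"
  shows "1 / 2 \<le> ln (real m)"
proof -
  have "exp (1 / 2 :: real) \<le> 2"
  proof (rule power2_le_imp_le)
    show "(exp (1 / 2 :: real))\<^sup>2 \<le> 2\<^sup>2" using exp_le by (simp flip: exp_double)
  qed simp
  also have "2 \<le> real m" using assms by simp
  finally show ?thesis using assms by (subst ln_ge_iff) auto
qed

text \<open>
  For \<open>m\<close> of order \<open>d / sqrt lam\<close> with \<open>d \<le> p\<close>, each pair of an index and a value has at most \<open>p\<^sup>1\<^sup>2 / sqrt lam\<close> possibilities.
  The factor \<open>1 / sqrt lam\<close> contributes \<open>ln (1 / lam) / 2\<close> to the logarithm, which is much less than the \<open>ln p / lam\<close> allowed.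
\<close>

lemma card_sparse_grid_le_exp:
  fixes lam :: real
  assumes p: "2 \<le> p" and d: "0 < d" "d \<le> p" and lam: "0 < lam" "lam \<le> 1"
    and m: "real m \<le> 258 * real d / sqrt lam + 1"
  shows "real (card (sparse_grid p d m)) \<le> exp (13 * real d * ln (real p) / lam)"
proof -
  have s: "0 < sqrt lam" "sqrt lam \<le> 1" using lam by auto
  have ln2: "1 / 2 \<le> ln (real p)" using p by (rule half_le_ln)
  have ge1: "1 \<le> real p / sqrt lam"
  proof -
    have "sqrt lam \<le> real p" using s(2) p by linarith
    then show ?thesis using s(1) by (simp add: le_divide_eq)
  qed
  have "real (2 * m + 1) \<le> 516 * (real d / sqrt lam) + 3" using m by simp
  also have "\<dots> \<le> 516 * (real p / sqrt lam) + 3 * (real p / sqrt lam)"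
  proof (intro add_mono mult_left_mono divide_right_mono)
    show "3 \<le> 3 * (real p / sqrt lam)" using ge1 by simp
  qed (use d s in auto)
  also have "\<dots> = 519 * (real p / sqrt lam)" by simp
  also have "\<dots> \<le> real p ^ 10 * (real p / sqrt lam)"
  proof (intro mult_right_mono)
    have "(2::real) ^ 10 \<le> real p ^ 10" using p by (intro power_mono) auto
    then show "519 \<le> real p ^ 10" by simp
  qed (use ge1 in linarith)
  finally have "real (p * (2 * m + 1)) \<le> real p * (real p ^ 10 * (real p / sqrt lam))"
    unfolding of_nat_mult by (intro mult_left_mono) auto
  also have "\<dots> = real p ^ 12 / sqrt lam" by (simp add: eval_nat_numeral)
  also have "\<dots> = exp (12 * ln (real p) + ln (1 / lam) / 2)"
  proof -
    have "real p ^ 12 = exp (12 * ln (real p))" using p exp_of_nat_mult[of 12 "ln (real p)"] by simp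
    moreover have "1 / sqrt lam = exp (ln (1 / lam) / 2)"
    proof -
      have "(exp (ln (1 / lam) / 2))\<^sup>2 = 1 / lam" using lam by (simp flip: exp_double)
      then have "sqrt (1 / lam) = exp (ln (1 / lam) / 2)" by (rule real_sqrt_unique) simp
      then show ?thesis by (simp add: real_sqrt_divide)
    qed
    ultimately show ?thesis
      using divide_inverse[of "real p ^ 12" "sqrt lam"] by (simp only: exp_add inverse_eq_divide)
  qed
  also have "\<dots> \<le> exp (13 * ln (real p) / lam)"
  proof -
    have "ln (1 / lam) \<le> 1 / lam - 1" using lam by (intro ln_le_minus_one) auto
    then have "ln (1 / lam) / 2 \<le> 1 / 2 * (1 / lam)" by simp
    also have "\<dots> \<le> ln (real p) * (1 / lam)" using ln2 lam by (intro mult_right_mono) auto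
    finally have "ln (1 / lam) / 2 \<le> ln (real p) / lam" by simp
    moreover have "ln (real p) * 1 \<le> ln (real p) * (1 / lam)"
      using lam ln2 by (intro mult_left_mono) auto
    ultimately show ?thesis by simp
  qed
  finally have base: "real (p * (2 * m + 1)) \<le> exp (13 * ln (real p) / lam)" .
  have "real (card (sparse_grid p d m)) \<le> real ((p * (2 * m + 1)) ^ d)"
    using card_sparse_grid_le[of p d m] p by (subst of_nat_le_iff) auto
  also have "\<dots> = real (p * (2 * m + 1)) ^ d" by simp
  also have "\<dots> \<le> exp (13 * ln (real p) / lam) ^ d" by (intro power_mono base) auto
  also have "\<dots> = exp (13 * real d * ln (real p) / lam)" by (simp add: exp_of_nat_mult[symmetric] mult_ac)
  finally show ?thesis .
qed

lemma l0_norm_diff_le: "l0_norm p (\<lambda>j. v j - w j) \<le> l0_norm p v + l0_norm p w"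
proof -
  have "{j \<in> {..<p}. v j - w j \<noteq> 0} \<subseteq> {j \<in> {..<p}. v j \<noteq> 0} \<union> {j \<in> {..<p}. w j \<noteq> 0}" by auto
  then have "l0_norm p (\<lambda>j. v j - w j) \<le> card ({j \<in> {..<p}. v j \<noteq> 0} \<union> {j \<in> {..<p}. w j \<noteq> 0})"
    unfolding l0_norm_def by (intro card_mono) auto
  also have "\<dots> \<le> l0_norm p v + l0_norm p w" unfolding l0_norm_def by (rule card_Un_le)
  finally show ?thesis .
qed

context sparse_regression begin

lemma measurable_sample_component:
  assumes "i < n"
  shows "(\<lambda>S. S i) \<in> sample \<rightarrow>\<^sub>M borel_vec p \<Otimes>\<^sub>M borel"
proof -
  have "(\<lambda>S. S i) \<in> PiM {..<n} (\<lambda>_. borel_vec p \<Otimes>\<^sub>M (borel :: real measure)) \<rightarrow>\<^sub>M borel_vec p \<Otimes>\<^sub>M borel"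
    using assms by (intro measurable_component_singleton) simp
  then show ?thesis by (subst measurable_cong_sets[OF sets_sample refl])
qed

lemma measurable_design_entry:
  assumes "i < n" "j < p"
  shows "(\<lambda>S. fst (S i) j) \<in> borel_measurable sample"
proof -
  have "(\<lambda>z. fst z j) \<in> borel_measurable (borel_vec p \<Otimes>\<^sub>M (borel :: real measure))"
    using assms(2) by (intro measurable_compose[OF measurable_fst] measurable_component_singleton) simp
  then show ?thesis using measurable_compose[OF measurable_sample_component[OF assms(1)]] by blast
qed

lemma measurable_design_dot:
  assumes "i < n"
  shows "(\<lambda>S. dot p v (fst (S i))) \<in> borel_measurable sample"
  unfolding dot_def
  by (rule borel_measurable_sum, rule borel_measurable_times[OF borel_measurable_const measurable_design_entry[OF assms]]) simp

text \<open>
  Union bound over the columns and over the grid of \<open>d\<close>-sparse vectors, \<open>d = min (2k) p\<close>. Each grid point fails with probability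
  at most \<open>exp (- n / 256)\<close>; the hypothesis on \<open>n\<close> lets the number of grid points consume at most half of this exponent.
\<close>

lemma restricted_eigenvalue:
  assumes k: "0 < k" and n: "real n \<ge> 4 * real k * 10000 * ln (real p) / lambda_min Cov"
  obtains G where "G \<in> sets sample" "sample.prob (space sample - G) \<le> exp (- real n / 512) + exp (- real n)"
    "\<And>S v. S \<in> G \<Longrightarrow> l0_norm p v \<le> 2 * k \<Longrightarrow>
       real n * sqrt (quad_form p Cov v) / 64 \<le> (\<Sum>i<n. \<bar>dot p v (fst (S i))\<bar>)"
proof -
  define lam where "lam = lambda_min Cov"
  have lam: "0 < lam" "lam \<le> 1" using lambda_pos lambda_le_1 by (auto simp: lam_def)
  define d where "d = min (2 * k) p"
  have d: "0 < d" "d \<le> p" "d \<le> 2 * k" using k p_pos by (auto simp: d_def)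
  define m where "m = nat \<lceil>258 * real d / sqrt lam\<rceil>"
  have m_ge: "258 * real d / sqrt lam \<le> real m" unfolding m_def by (rule real_nat_ceiling_ge)
  have m_pos: "0 < 258 * real d / sqrt lam" using d lam by simp
  have m: "0 < m" "258 * real d \<le> real m * sqrt lam" "real m \<le> 258 * real d / sqrt lam + 1"
  proof -
    show "0 < m" using m_ge m_pos by (simp add: order.strict_trans2)
    show "258 * real d \<le> real m * sqrt lam" using m_ge lam by (simp add: field_simps)
    show "real m \<le> 258 * real d / sqrt lam + 1" using m_pos unfolding m_def by linarith
  qed
  \<comment> \<open>Grid points of vanishing quadratic form satisfy their bound trivially.\<close>
  define Z where "Z = {z \<in> sparse_grid p d m. 0 < quad_form p Cov z}"
  have fin: "finite (sparse_grid p d m)" by (rule finite_sparse_grid[OF p_pos])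
  then have Z: "finite Z" by (simp add: Z_def)
  define B where "B j = {S \<in> space sample. 4 * real n \<le> (\<Sum>i<n. \<bar>fst (S i) j\<bar>)}" for j
  define C where "C z = {S \<in> space sample. (\<Sum>i<n. \<bar>dot p z (fst (S i))\<bar>) \<le> real n * sqrt (quad_form p Cov z) / 32}" for z
  have [measurable]: "B j \<in> sets sample" if "j < p" for j
    unfolding B_def using measurable_design_entry that
    by (intro borel_measurable_le borel_measurable_sum borel_measurable_abs) auto
  have [measurable]: "C z \<in> sets sample" for z
    unfolding C_def using measurable_design_dot
    by (intro borel_measurable_le borel_measurable_sum borel_measurable_abs) auto
  define Bad where "Bad = (\<Union>j<p. B j) \<union> (\<Union>z\<in>Z. C z)"
  have Bad: "Bad \<in> sets sample" unfolding Bad_def using Z by (intro sets.Un sets.finite_UN) auto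
  have lnp: "0 \<le> ln (real p)" using p_ge_2 by simp
  have le_div: "x \<le> x / lam" if "0 \<le> x" for x
    using lam that mult_left_le_one_le[of x lam] by (simp add: le_divide_eq mult.commute)
  have n': "40000 * (real k * ln (real p) / lam) \<le> real n" using n by (simp add: lam_def mult_ac)
  have lnp_n: "ln (real p) \<le> real n"
  proof -
    have "ln (real p) \<le> real k * ln (real p)" using k lnp by (simp add: mult_le_cancel_right1)
    also have "\<dots> \<le> real k * ln (real p) / lam" using lnp by (intro le_div) auto
    also have "\<dots> \<le> 40000 * (real k * ln (real p) / lam)"
      using divide_nonneg_pos[OF mult_nonneg_nonneg[OF of_nat_0_le_iff lnp] lam(1), of k]
      by (simp only: mult_le_cancel_right1) simp
    finally show ?thesis using n' by linarith
  qed
  have prob_B: "sample.prob (B j) \<le> exp (- 2 * real n)" if "j < p" for j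
    unfolding B_def by (rule prob_column_sum_large[OF that])
  have prob_C: "sample.prob (C z) \<le> exp (- real n / 256)" if "z \<in> Z" for z
    unfolding C_def using that by (intro prob_design_sum_small) (simp add: Z_def)
  have "sample.prob Bad \<le> sample.prob (\<Union>j<p. B j) + sample.prob (\<Union>z\<in>Z. C z)"
    unfolding Bad_def using Z by (intro measure_Un_le sets.finite_UN) auto
  also have "sample.prob (\<Union>j<p. B j) \<le> (\<Sum>j<p. exp (- 2 * real n))"
    by (intro order.trans[OF sample.finite_measure_subadditive_finite] sum_mono prob_B) auto
  also have "(\<Sum>j<p. exp (- 2 * real n)) = exp (ln (real p) - 2 * real n)"
    using p_pos by (simp add: exp_diff exp_minus divide_inverse)
  also have "\<dots> \<le> exp (- real n)" using lnp_n by simp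
  also have "sample.prob (\<Union>z\<in>Z. C z) \<le> (\<Sum>z\<in>Z. exp (- real n / 256))"
    using Z by (intro order.trans[OF sample.finite_measure_subadditive_finite] sum_mono prob_C) auto
  also have "\<dots> \<le> exp (13 * real d * ln (real p) / lam) * exp (- real n / 256)"
  proof -
    have "real (card Z) \<le> real (card (sparse_grid p d m))"
      using fin by (auto simp: Z_def intro!: card_mono)
    also have "\<dots> \<le> exp (13 * real d * ln (real p) / lam)"
      by (rule card_sparse_grid_le_exp[OF p_ge_2 d(1,2) lam m(3)])
    finally show ?thesis by (simp add: mult_right_mono)
  qed
  also have "\<dots> \<le> exp (- real n / 512)"
  proof -
    have "13 * real d * ln (real p) / lam \<le> 13 * real (2 * k) * ln (real p) / lam"
      using d lnp lam by (intro divide_right_mono mult_right_mono mult_left_mono) auto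
    also have "\<dots> = 26 * (real k * ln (real p) / lam)" by simp
    also have "\<dots> \<le> real n / 512"
    proof -
      have "0 \<le> real k * ln (real p) / lam" using lnp lam by simp
      then show ?thesis using n' by linarith
    qed
    finally show ?thesis by (simp flip: exp_add)
  qed
  finally have prob: "sample.prob Bad \<le> exp (- real n / 512) + exp (- real n)" by simp
  show ?thesis
  proof (rule that[of "space sample - Bad"])
    show "space sample - Bad \<in> sets sample" using Bad by auto
    have "space sample - (space sample - Bad) = Bad" using sets.sets_into_space[OF Bad] by auto
    then show "sample.prob (space sample - (space sample - Bad)) \<le> exp (- real n / 512) + exp (- real n)"
      using prob by simp
    fix S v assume S: "S \<in> space sample - Bad" and v: "l0_norm p v \<le> 2 * k"
    show "real n * sqrt (quad_form p Cov v) / 64 \<le> (\<Sum>i<n. \<bar>dot p v (fst (S i))\<bar>)"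
    proof (rule restricted_eigenvalue_from_grid[where d = d and m = m])
      show "(\<Sum>i<n. \<bar>fst (S i) j\<bar>) \<le> 4 * real n" if "j < p" for j
        using S that by (force simp: Bad_def B_def)
      show "real n * sqrt (quad_form p Cov z) / 32 \<le> (\<Sum>i<n. \<bar>dot p z (fst (S i))\<bar>)"
        if z: "z \<in> sparse_grid p d m" for z
      proof (cases "0 < quad_form p Cov z")
        case True
        then show ?thesis using S z by (force simp: Bad_def C_def Z_def)
      next
        case False
        then have "quad_form p Cov z = 0" using quad_form_Cov_nonneg[of z] by simp
        then show ?thesis by (simp add: sum_nonneg)
      qed
      show "0 < m" "258 * real d \<le> real m * sqrt (lambda_min Cov)" using m by (auto simp: lam_def)
      have "l0_norm p v \<le> p" unfolding l0_norm_def using card_mono[of "{..<p}" "{j \<in> {..<p}. v j \<noteq> 0}"] by auto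
      then show "l0_norm p v \<le> d" using v by (simp add: d_def)
    qed
  qed
qed

section \<open>The population risk\<close>

definition noise_var :: real where "noise_var = (\<integral>e. e\<^sup>2 \<partial>De)"

lemma
  shows integrable_noise_square: "integrable De (\<lambda>e. e\<^sup>2)"
    and noise_var_le: "noise_var \<le> 8 * (exp (\<sigma>\<^sup>2 / 2) - 1)"
proof -
  have g: "integrable De (\<lambda>e. exp (t * e))" "(\<integral>e. exp (t * e) \<partial>De) \<le> exp (\<sigma>\<^sup>2 * t\<^sup>2 / 2)" for t
    using noise_subgaussian by (auto simp: subgaussian_def)
  have i: "integrable De (\<lambda>e. exp e)" "integrable De (\<lambda>e. exp (- e))" using g(1)[of 1] g(1)[of "- 1"] by auto
  have i': "integrable De (\<lambda>e. 4 * (exp e + exp (- e) - 2))" using i by simp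
  show sq: "integrable De (\<lambda>e. e\<^sup>2)"
  proof (rule Bochner_Integration.integrable_bound[OF i'])
    show "AE e in De. norm (e\<^sup>2) \<le> norm (4 * (exp e + exp (- e) - 2))"
      using exp_square_le_exp_sum order.trans[OF _ abs_ge_self] by (intro AE_I2) (simp only: real_norm_def abs_power2, blast)
    have "(\<lambda>e. e) \<in> borel_measurable De" using noise_subgaussian unfolding subgaussian_def by (blast dest: borel_measurable_integrable)
    then show "(\<lambda>e. e\<^sup>2) \<in> borel_measurable De" by (rule borel_measurable_power)
  qed
  have "noise_var \<le> (\<integral>e. 4 * (exp e + exp (- e) - 2) \<partial>De)"
    unfolding noise_var_def using exp_square_le_exp_sum by (intro integral_mono sq i')
  also have "\<dots> = 4 * ((\<integral>e. exp e \<partial>De) + (\<integral>e. exp (- e) \<partial>De) - 2)"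
    using i by (simp add: E.prob_space)
  also have "\<dots> \<le> 8 * (exp (\<sigma>\<^sup>2 / 2) - 1)" using g(2)[of 1] g(2)[of "- 1"] by simp
  finally show "noise_var \<le> 8 * (exp (\<sigma>\<^sup>2 / 2) - 1)" .
qed

lemma noise_var_nonneg: "0 \<le> noise_var"
  unfolding noise_var_def by (intro Bochner_Integration.integral_nonneg) auto

text \<open>
  The mixed term \<open>e \<langle>w - wbar, x\<rangle>\<close> integrates to zero, since the noise is centred and independent of the design.
\<close>

lemma
  shows integrable_loss: "integrable obs (loss p w)"
    and risk_eq: "risk p obs w = (noise_var + quad_form p Cov (\<lambda>j. w j - wbar j)) / 2"
proof -
  define \<Delta> where "\<Delta> = (\<lambda>j. w j - wbar j)"
  have [measurable]: "loss p w \<in> borel_measurable (borel_vec p \<Otimes>\<^sub>M borel)"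
    unfolding loss_def by measurable
  define h where "h = (\<lambda>(x, e). loss p w (x, dot p wbar x + e))"
  have h_eq: "h (x, e) = e\<^sup>2 / 2 - dot p \<Delta> x * e + (dot p \<Delta> x)\<^sup>2 / 2" for x e
    by (simp add: h_def loss_def \<Delta>_def dot_diff_left power2_eq_square field_simps)
  have h_comp: "h = (\<lambda>y. loss p w ((\<lambda>(x, e). (x, dot p wbar x + e)) y))" by (auto simp: h_def)
  have h_meas: "h \<in> borel_measurable (Dx \<Otimes>\<^sub>M De)"
    unfolding h_comp by (rule measurable_compose[OF measurable_obs_map]) fact
  have e: "integrable De (\<lambda>e. e)" "(\<integral>e. e \<partial>De) = 0" using noise_subgaussian by (auto simp: subgaussian_def)
  have in_e: "integrable De (\<lambda>e. h (x, e))" for x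
    unfolding h_eq using e(1) integrable_noise_square by simp
  have inner: "(\<integral>e. h (x, e) \<partial>De) = (noise_var + dot p \<Delta> x * dot p \<Delta> x) / 2" for x
    unfolding h_eq using e integrable_noise_square
    by (simp add: noise_var_def E.prob_space power2_eq_square add_divide_distrib)
  have outer: "integrable Dx (\<lambda>x. (noise_var + dot p \<Delta> x * dot p \<Delta> x) / 2)"
    using integrable_dot_product[of \<Delta> \<Delta>] by simp
  have h_nn: "0 \<le> h y" for y by (simp add: h_def loss_def split: prod.split)
  have int_h: "integrable (Dx \<Otimes>\<^sub>M De) h"
  proof (rule XE.Fubini_integrable)
    show "integrable Dx (\<lambda>x. \<integral>e. norm (h (x, e)) \<partial>De)" using outer by (simp add: h_nn inner)
  qed (simp_all only: in_e h_meas AE_I2)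
  show "integrable obs (loss p w)"
    unfolding obs_law_def
    by (subst integrable_distr_eq[OF measurable_obs_map], fact, rule int_h[unfolded h_comp])
  have "risk p obs w = (\<integral>y. h y \<partial>(Dx \<Otimes>\<^sub>M De))"
    unfolding risk_def obs_law_def h_comp by (rule integral_distr[OF measurable_obs_map]) fact
  also have "\<dots> = (\<integral>x. \<integral>e. h (x, e) \<partial>De \<partial>Dx)" using int_h by (rule XE.integral_fst'[symmetric])
  also have "\<dots> = (noise_var + quad_form p Cov \<Delta>) / 2"
    unfolding inner using integrable_dot_product[of \<Delta> \<Delta>]
    by (simp add: integral_dot_product quad_form_eq_bilin X.prob_space)
  finally show "risk p obs w = (noise_var + quad_form p Cov (\<lambda>j. w j - wbar j)) / 2" by (simp add: \<Delta>_def)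
qed

end

section \<open>Correlation of the noise with the design\<close>

text \<open>
  A square exceeds \<open>a\<^sup>2\<close> by no more than an exponential of the excess \<open>u - a\<close>. With \<open>a\<close> of order \<open>ln p\<close> the exponential
  absorbs a union bound over \<open>p\<close> variables, which yields second moments of maxima from the moment generating function.
\<close>

lemma square_le_exp_excess:
  fixes u a :: real
  assumes "0 \<le> u" "0 \<le> a"
  shows "u\<^sup>2 \<le> a\<^sup>2 + (2 * a + 2) * exp (u - a)"
proof (cases "u \<le> a")
  case True
  then have "u\<^sup>2 \<le> a\<^sup>2" using assms by (intro power_mono)
  moreover have "0 \<le> (2 * a + 2) * exp (u - a)" using assms by simp
  ultimately show ?thesis by linarith
next
  case False
  define x where "x = u - a"
  have x: "0 \<le> x" using False by (simp add: x_def)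
  have "1 + x + x\<^sup>2 / 2 \<le> exp x" using x by (rule exp_lower_Taylor_quadratic)
  then have e: "x \<le> exp x" "x\<^sup>2 \<le> 2 * exp x" using x zero_le_power2[of x] by linarith+
  have "u\<^sup>2 = a\<^sup>2 + 2 * a * x + x\<^sup>2" by (simp add: x_def power2_eq_square algebra_simps)
  also have "\<dots> \<le> a\<^sup>2 + 2 * a * exp x + 2 * exp x"
    using e mult_left_mono[OF e(1), of "2 * a"] assms by linarith
  finally show ?thesis by (simp add: x_def algebra_simps)
qed

lemma l1_le_sqrt_sparsity:
  assumes "l0_norm p v \<le> d"
  shows "(\<Sum>j<p. \<bar>v j\<bar>) \<le> sqrt (real d) * L2_set v {..<p}"
proof -
  have "(\<Sum>j<p. \<bar>v j\<bar>) = (\<Sum>j<p. \<bar>(if v j \<noteq> 0 then 1 else 0)\<bar> * \<bar>v j\<bar>)"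
    by (intro sum.cong) auto
  also have "\<dots> \<le> L2_set (\<lambda>j. if v j \<noteq> 0 then 1 else 0) {..<p} * L2_set v {..<p}"
    by (rule L2_set_mult_ineq)
  also have "L2_set (\<lambda>j. if v j \<noteq> 0 then 1 else (0::real)) {..<p} = sqrt (real (l0_norm p v))"
    by (simp add: L2_set_def l0_norm_def if_distrib[of "\<lambda>x. x\<^sup>2"] sum.If_cases Int_def cong: if_cong)
  also have "\<dots> * L2_set v {..<p} \<le> sqrt (real d) * L2_set v {..<p}"
    using assms by (intro mult_right_mono) auto
  finally show ?thesis .
qed

context sparse_regression begin

text \<open>
  The unnormalized correlation \<open>n Z\<^sub>j\<close>, which is a sum of independent terms.
\<close>

definition noise_corr :: "(nat \<Rightarrow> (nat \<Rightarrow> real) \<times> real) \<Rightarrow> nat \<Rightarrow> real" where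
  "noise_corr S j = (\<Sum>i<n. fst (S i) j * noise (S i))"

lemma measurable_noise_product:
  assumes "j < p"
  shows "(\<lambda>z. fst z j * noise z) \<in> borel_measurable (borel_vec p \<Otimes>\<^sub>M borel)"
proof -
  have "(\<lambda>z. fst z j) \<in> borel_measurable (borel_vec p \<Otimes>\<^sub>M (borel :: real measure))"
    using assms by (intro measurable_compose[OF measurable_fst] measurable_component_singleton) simp
  then show ?thesis by (intro borel_measurable_times measurable_noise)
qed

lemma measurable_noise_term:
  assumes "j < p"
  shows "(\<lambda>z. s * (fst z j * noise z)) \<in> borel_measurable obs"
  by (subst measurable_cong_sets[OF sets_obs refl])
    (intro borel_measurable_times[OF borel_measurable_const] measurable_noise_product assms)

lemma noise_corr_scaled: "s * noise_corr S j = (\<Sum>i<n. s * (fst (S i) j * noise (S i)))"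
  by (simp add: noise_corr_def sum_distrib_left)

lemma measurable_noise_corr:
  assumes "j < p"
  shows "(\<lambda>S. noise_corr S j) \<in> borel_measurable sample"
  unfolding noise_corr_def
  by (rule borel_measurable_sum, rule measurable_compose[OF measurable_sample_component measurable_noise_product[OF assms]]) simp

lemma nn_integral_exp_noise_corr_le:
  assumes "j < p" "2 * \<sigma>\<^sup>2 * s\<^sup>2 \<le> 1"
  shows "(\<integral>\<^sup>+S. ennreal (exp (s * noise_corr S j)) \<partial>sample) \<le> ennreal (exp (real n * (2 * \<sigma>\<^sup>2 * s\<^sup>2)))"
  unfolding noise_corr_scaled sample_law_def
  by (rule nn_integral_exp_sum_iid_le[OF obs.prob_space_axioms measurable_noise_term mgf_noise_coord]) fact+

lemma
  assumes "j < p" "2 * \<sigma>\<^sup>2 * s\<^sup>2 \<le> 1"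
  shows integrable_exp_noise_corr: "integrable sample (\<lambda>S. exp (s * noise_corr S j))"
    and integral_exp_noise_corr_le: "(\<integral>S. exp (s * noise_corr S j) \<partial>sample) \<le> exp (real n * (2 * \<sigma>\<^sup>2 * s\<^sup>2))"
proof -
  note le = nn_integral_exp_noise_corr_le[OF assms]
  show i: "integrable sample (\<lambda>S. exp (s * noise_corr S j))"
  proof (rule integrableI_nonneg)
    have "(\<lambda>S. s * noise_corr S j) \<in> borel_measurable sample"
      by (intro borel_measurable_times borel_measurable_const measurable_noise_corr assms)
    then show "(\<lambda>S. exp (s * noise_corr S j)) \<in> borel_measurable sample"
      by (rule measurable_compose[OF _ borel_measurable_exp])
    show "(\<integral>\<^sup>+S. ennreal (exp (s * noise_corr S j)) \<partial>sample) < \<infinity>"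
      using le by (rule order.strict_trans1) simp
  qed simp
  show "(\<integral>S. exp (s * noise_corr S j) \<partial>sample) \<le> exp (real n * (2 * \<sigma>\<^sup>2 * s\<^sup>2))"
    using le by (simp add: nn_integral_eq_integral[OF i])
qed

lemma noise_vanishes:
  assumes "\<sigma> = 0"
  shows "AE S in sample. \<forall>j. noise_corr S j = 0"
proof -
  have "noise_var = 0" using noise_var_le noise_var_nonneg assms by simp
  then have De0: "(\<integral>\<^sup>+e. ennreal (e\<^sup>2) \<partial>De) = 0"
    using nn_integral_eq_integral[OF integrable_noise_square] by (simp add: noise_var_def)
  have meas: "(\<lambda>z. ennreal ((noise z)\<^sup>2)) \<in> borel_measurable (borel_vec p \<Otimes>\<^sub>M borel)"
    by (intro measurable_compose[OF _ measurable_ennreal] borel_measurable_power measurable_noise)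
  have "(\<integral>\<^sup>+z. ennreal ((noise z)\<^sup>2) \<partial>obs) = 0"
    unfolding nn_integral_obs[OF meas] by (simp add: noise_def De0)
  moreover have "(\<lambda>z. ennreal ((noise z)\<^sup>2)) \<in> borel_measurable obs"
    using meas by (subst measurable_cong_sets[OF sets_obs refl])
  ultimately have "AE z in obs. ennreal ((noise z)\<^sup>2) = 0"
    by (subst (asm) nn_integral_0_iff_AE)
  then have "AE z in obs. noise z = 0" by eventually_elim (simp add: ennreal_eq_0_iff)
  then have "AE S in sample. noise (S i) = 0" if "i < n" for i
    unfolding sample_law_def using that obs.prob_space_axioms
    by (intro AE_PiM_component[where P = "\<lambda>z. noise z = 0"]) auto
  then have "AE S in sample. \<forall>i\<in>{..<n}. noise (S i) = 0"
    by (intro AE_finite_allI) auto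
  then show ?thesis by eventually_elim (simp add: noise_corr_def)
qed

lemma prob_noise_corr_large:
  assumes j: "j < p" and s: "0 < s" "2 * \<sigma>\<^sup>2 * s\<^sup>2 \<le> 1"
  shows "sample.prob {S \<in> space sample. t \<le> \<bar>noise_corr S j\<bar>} \<le> 2 * exp (real n * (2 * \<sigma>\<^sup>2 * s\<^sup>2) - s * t)"
proof -
  define A where "A c = {S \<in> space sample. s * t \<le> (\<Sum>i<n. c * (fst (S i) j * noise (S i)))}" for c
  have A_eq: "A c = {S \<in> space sample. s * t \<le> c * noise_corr S j}" for c
    by (simp only: A_def noise_corr_scaled)
  have A: "sample.prob (A c) \<le> exp (real n * (2 * \<sigma>\<^sup>2 * s\<^sup>2) - s * t)" if "c\<^sup>2 = s\<^sup>2" for c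
    using Chernoff_iid[OF obs.prob_space_axioms measurable_noise_term[OF j] mgf_noise_coord[OF j], of c n "s * t"] s that
    unfolding A_def by (simp add: sample_law_def)
  have A_sets: "A c \<in> sets sample" for c
    unfolding A_eq
    by (intro borel_measurable_le borel_measurable_times borel_measurable_const measurable_noise_corr j)
  have "{S \<in> space sample. t \<le> \<bar>noise_corr S j\<bar>} \<subseteq> A s \<union> A (- s)"
  proof
    fix S assume S: "S \<in> {S \<in> space sample. t \<le> \<bar>noise_corr S j\<bar>}"
    then have "s * t \<le> s * \<bar>noise_corr S j\<bar>" using s by (intro mult_left_mono) auto
    then show "S \<in> A s \<union> A (- s)" using S unfolding A_eq by (auto simp: abs_if split: if_splits)
  qed
  then have "sample.prob {S \<in> space sample. t \<le> \<bar>noise_corr S j\<bar>} \<le> sample.prob (A s \<union> A (- s))"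
    by (intro sample.finite_measure_mono) (auto intro: A_sets)
  also have "\<dots> \<le> sample.prob (A s) + sample.prob (A (- s))" by (intro measure_Un_le A_sets)
  also have "\<dots> \<le> 2 * exp (real n * (2 * \<sigma>\<^sup>2 * s\<^sup>2) - s * t)" using A[of s] A[of "- s"] by simp
  finally show ?thesis .
qed

text \<open>
  Chernoff bound with \<open>s\<^sup>2 = l / (2 \<sigma>\<^sup>2 n)\<close>, \<open>l = ln (2p / \<delta>)\<close>. The condition \<open>l \<le> n\<close> keeps \<open>s\<close> in the range where the moment generating function
  of a product of sub-Gaussian variables is controlled. For \<open>\<sigma> = 0\<close> the noise vanishes almost surely.
\<close>

lemma noise_corr_tail:
  assumes \<delta>: "0 < \<delta>" "\<delta> \<le> 1" and L: "ln (2 * real p / \<delta>) \<le> real n"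
  shows "sample.prob {S \<in> space sample. \<not> (\<forall>j<p. (noise_corr S j)\<^sup>2 \<le> 8 * \<sigma>\<^sup>2 * real n * ln (2 * real p / \<delta>))} \<le> \<delta>"
proof (cases "\<sigma> = 0")
  case True
  have "AE S in sample. \<not> \<not> (\<forall>j<p. (noise_corr S j)\<^sup>2 \<le> 8 * \<sigma>\<^sup>2 * real n * ln (2 * real p / \<delta>))"
    using noise_vanishes[OF True] by eventually_elim (simp add: True)
  then show ?thesis
    using \<delta> by (subst sample.prob_eq_0_AE) auto
next
  case False
  define l where "l = ln (2 * real p / \<delta>)"
  have "1 < 2 * real p / \<delta>" using \<delta> p_ge_2 by (simp add: field_simps)
  then have l: "0 < l" "l \<le> real n" using L by (auto simp: l_def)
  have n: "0 < real n" using n_pos by simp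
  define s where "s = sqrt (l / (2 * \<sigma>\<^sup>2 * real n))"
  define t where "t = sqrt (8 * \<sigma>\<^sup>2 * real n * l)"
  have s: "0 < s" using False l n by (simp add: s_def)
  have s2: "2 * \<sigma>\<^sup>2 * s\<^sup>2 = l / real n" using False l n by (simp add: s_def)
  have st: "s * t = 2 * l"
  proof -
    have "s * t = sqrt ((2 * l)\<^sup>2)"
      unfolding s_def t_def real_sqrt_mult[symmetric] using False n
      by (intro arg_cong[of _ _ sqrt]) (simp add: power2_eq_square field_simps)
    then show ?thesis using l by (simp only: real_sqrt_abs)
  qed
  define A where "A j = {S \<in> space sample. t \<le> \<bar>noise_corr S j\<bar>}" for j
  have prob_A: "sample.prob (A j) \<le> \<delta> / real p" if "j < p" for j
  proof -
    have "sample.prob (A j) \<le> 2 * exp (real n * (2 * \<sigma>\<^sup>2 * s\<^sup>2) - s * t)"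
      unfolding A_def using l n s2 by (intro prob_noise_corr_large that s) simp
    also have "real n * (2 * \<sigma>\<^sup>2 * s\<^sup>2) - s * t = - l" using n by (simp add: s2 st)
    also have "2 * exp (- l) = \<delta> / real p"
      using \<delta> p_pos by (simp add: l_def exp_minus)
    finally show ?thesis .
  qed
  have A_sets: "A j \<in> sets sample" if "j < p" for j
    unfolding A_def using that
    by (intro borel_measurable_le borel_measurable_abs borel_measurable_const measurable_noise_corr)
  have "{S \<in> space sample. \<not> (\<forall>j<p. (noise_corr S j)\<^sup>2 \<le> 8 * \<sigma>\<^sup>2 * real n * l)} \<subseteq> (\<Union>j<p. A j)"
  proof
    fix S assume "S \<in> {S \<in> space sample. \<not> (\<forall>j<p. (noise_corr S j)\<^sup>2 \<le> 8 * \<sigma>\<^sup>2 * real n * l)}"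
    then obtain j where j: "j < p" "8 * \<sigma>\<^sup>2 * real n * l < (noise_corr S j)\<^sup>2" "S \<in> space sample" by (auto simp: not_le)
    then have "t \<le> sqrt ((noise_corr S j)\<^sup>2)" unfolding t_def by (intro real_sqrt_le_mono) simp
    then show "S \<in> (\<Union>j<p. A j)" using j by (auto simp: A_def)
  qed
  then have "sample.prob {S \<in> space sample. \<not> (\<forall>j<p. (noise_corr S j)\<^sup>2 \<le> 8 * \<sigma>\<^sup>2 * real n * l)} \<le> sample.prob (\<Union>j<p. A j)"
    using A_sets by (intro sample.finite_measure_mono) auto
  also have "\<dots> \<le> (\<Sum>j<p. \<delta> / real p)"
    using A_sets by (intro order.trans[OF sample.finite_measure_subadditive_finite] sum_mono prob_A) auto
  also have "\<dots> = \<delta>" using p_pos by simp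
  finally show ?thesis by (simp add: l_def)
qed

text \<open>
  The majorant \<open>H\<close> dominates all the squares simultaneously, so it stands for \<open>max\<^sub>j Z\<^sub>j\<^sup>2\<close>. Its mean is computed
  from \<open>square_le_exp_excess\<close> with the maximum in the exponential replaced by a sum over both signs and all columns.
\<close>

lemma noise_corr_second_moment:
  assumes \<sigma>: "\<sigma> \<noteq> 0" and n: "ln (2 * real p) \<le> real n"
  obtains H where "integrable sample H" "\<And>S. 0 \<le> H S" "\<And>S j. j < p \<Longrightarrow> (noise_corr S j / real n)\<^sup>2 \<le> H S"
    "(\<integral>S. H S \<partial>sample) \<le> 40 * \<sigma>\<^sup>2 * ln (real p) / real n"
proof -
  define l where "l = ln (2 * real p)"
  have l1: "1 \<le> l"
  proof -
    have "exp 1 \<le> 2 * real p" using exp_le p_ge_2 by linarith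
    then show ?thesis unfolding l_def using p_pos by (subst ln_ge_iff) auto
  qed
  have l2: "l \<le> 2 * ln (real p)" using p_ge_2 by (simp add: l_def ln_mult)
  have n0: "0 < real n" using n_pos by simp
  define s where "s = sqrt (l / (2 * \<sigma>\<^sup>2 * real n))"
  have s: "0 < s" using \<sigma> l1 n0 by (simp add: s_def)
  have s_sq: "s\<^sup>2 = l / (2 * \<sigma>\<^sup>2 * real n)" using l1 n0 by (simp add: s_def)
  have s2: "2 * \<sigma>\<^sup>2 * s\<^sup>2 = l / real n" "2 * \<sigma>\<^sup>2 * s\<^sup>2 \<le> 1" "2 * \<sigma>\<^sup>2 * (- s)\<^sup>2 \<le> 1"
    using \<sigma> n0 n by (simp_all add: s_sq l_def)
  \<comment> \<open>The sum \<open>T\<close> below has mean at most \<open>4 p\<^sup>2 = exp (2 l)\<close>; the threshold \<open>a = 2 l\<close> compensates it exactly.\<close>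
  define a where "a = 2 * l"
  define c where "c = (2 * a + 2) * exp (- a)"
  have a: "0 \<le> a" "0 \<le> c" using l1 by (auto simp: a_def c_def)
  define T where "T S = (\<Sum>j<p. exp (s * noise_corr S j) + exp ((- s) * noise_corr S j))" for S
  define H where "H S = (a\<^sup>2 + c * T S) / (s * real n)\<^sup>2" for S
  have T_nn: "0 \<le> T S" for S unfolding T_def by (intro sum_nonneg) simp
  have T_int: "integrable sample T"
    unfolding T_def using s2
    by (intro Bochner_Integration.integrable_sum Bochner_Integration.integrable_add integrable_exp_noise_corr) auto
  have "(\<integral>S. T S \<partial>sample) = (\<Sum>j<p. (\<integral>S. exp (s * noise_corr S j) \<partial>sample) + (\<integral>S. exp ((- s) * noise_corr S j) \<partial>sample))"
    unfolding T_def using s2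
    by (subst Bochner_Integration.integral_sum;
        (intro sum.cong refl Bochner_Integration.integral_add Bochner_Integration.integrable_add integrable_exp_noise_corr)?) auto
  also have "\<dots> \<le> (\<Sum>j<p. 2 * real p + 2 * real p)"
  proof (intro sum_mono add_mono)
    have e: "exp (real n * (2 * \<sigma>\<^sup>2 * s\<^sup>2)) = 2 * real p"
      unfolding s2(1) using n0 p_pos by (simp add: l_def)
    show "(\<integral>S. exp (s * noise_corr S j) \<partial>sample) \<le> 2 * real p" if "j \<in> {..<p}" for j
      using integral_exp_noise_corr_le[OF _ s2(2), of j] that unfolding e by simp
    show "(\<integral>S. exp ((- s) * noise_corr S j) \<partial>sample) \<le> 2 * real p" if "j \<in> {..<p}" for j
      using integral_exp_noise_corr_le[OF _ s2(3), of j] that unfolding power2_minus e by simp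
  qed
  also have "\<dots> = exp a"
    using p_pos exp_double[of l] by (simp add: a_def l_def power2_eq_square)
  finally have T_le: "(\<integral>S. T S \<partial>sample) \<le> exp a" .
  show ?thesis
  proof (rule that)
    show "integrable sample H" unfolding H_def using T_int by simp
    show "0 \<le> H S" for S unfolding H_def using T_nn a by simp
    show "(noise_corr S j / real n)\<^sup>2 \<le> H S" if "j < p" for S j
    proof -
      define x where "x = s * noise_corr S j"
      have "\<bar>x\<bar>\<^sup>2 \<le> a\<^sup>2 + (2 * a + 2) * exp (\<bar>x\<bar> - a)"
        using a by (intro square_le_exp_excess) auto
      also have "(2 * a + 2) * exp (\<bar>x\<bar> - a) = c * exp \<bar>x\<bar>"
        by (simp add: c_def exp_diff exp_minus divide_inverse)
      also have "c * exp \<bar>x\<bar> \<le> c * T S"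
      proof (intro mult_left_mono a)
        have "exp \<bar>x\<bar> \<le> exp (s * noise_corr S j) + exp ((- s) * noise_corr S j)"
          by (cases "0 \<le> x") (auto simp: x_def)
        also have "\<dots> \<le> T S" unfolding T_def using that by (intro member_le_sum) auto
        finally show "exp \<bar>x\<bar> \<le> T S" .
      qed
      finally have "x\<^sup>2 / (s * real n)\<^sup>2 \<le> H S" unfolding H_def by (intro divide_right_mono) auto
      moreover have "x\<^sup>2 / (s * real n)\<^sup>2 = (noise_corr S j / real n)\<^sup>2"
        using s by (simp add: x_def power_mult_distrib power_divide)
      ultimately show ?thesis by simp
    qed
    have "(\<integral>S. H S \<partial>sample) = (a\<^sup>2 + c * (\<integral>S. T S \<partial>sample)) / (s * real n)\<^sup>2"
      unfolding H_def using T_int by (simp add: sample.prob_space)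
    also have "\<dots> \<le> (a\<^sup>2 + c * exp a) / (s * real n)\<^sup>2"
      by (intro divide_right_mono add_left_mono mult_left_mono T_le a) simp
    also have "a\<^sup>2 + c * exp a = 4 * l\<^sup>2 + 4 * l + 2"
      by (simp add: c_def a_def exp_minus power2_eq_square)
    also have "(s * real n)\<^sup>2 = real n * l / (2 * \<sigma>\<^sup>2)"
      unfolding power_mult_distrib s_sq using n0 by (simp add: power2_eq_square)
    also have "(4 * l\<^sup>2 + 4 * l + 2) / (real n * l / (2 * \<sigma>\<^sup>2)) \<le> 10 * l\<^sup>2 / (real n * l / (2 * \<sigma>\<^sup>2))"
    proof (intro divide_right_mono)
      have "1 * l \<le> l * l" "1 \<le> l * l" using l1 mult_mono[OF l1 l1] by (auto intro: mult_right_mono)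
      then show "4 * l\<^sup>2 + 4 * l + 2 \<le> 10 * l\<^sup>2" unfolding power2_eq_square by linarith
      show "0 \<le> real n * l / (2 * \<sigma>\<^sup>2)" using l1 by simp
    qed
    also have "\<dots> = 20 * \<sigma>\<^sup>2 * l / real n"
      using l1 \<sigma> n0 by (simp add: power2_eq_square field_simps)
    also have "\<dots> \<le> 20 * \<sigma>\<^sup>2 * (2 * ln (real p)) / real n"
      using l2 by (intro divide_right_mono mult_left_mono) auto
    finally show "(\<integral>S. H S \<partial>sample) \<le> 40 * \<sigma>\<^sup>2 * ln (real p) / real n" by simp
  qed
qed

section \<open>The basic inequality\<close>

lemma emp_risk_gap:
  "emp_risk p n S wbar - emp_risk p n S w
    = (\<Sum>j<p. (w j - wbar j) * (noise_corr S j / real n))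
      - (\<Sum>i<n. (dot p (\<lambda>j. w j - wbar j) (fst (S i)))\<^sup>2) / (2 * real n)"
proof -
  define D where "D i = dot p (\<lambda>j. w j - wbar j) (fst (S i))" for i
  have res: "snd (S i) - dot p w (fst (S i)) = noise (S i) - D i" for i
    by (simp add: noise_def D_def dot_diff_left)
  have res0: "snd (S i) - dot p wbar (fst (S i)) = noise (S i)" for i
    by (simp add: noise_def)
  have corr: "(\<Sum>i<n. noise (S i) * D i) = (\<Sum>j<p. (w j - wbar j) * noise_corr S j)"
    unfolding D_def dot_def noise_corr_def sum_distrib_left
    by (subst sum.swap) (intro sum.cong refl, simp add: mult_ac)
  have "emp_risk p n S wbar - emp_risk p n S w
      = 1 / (2 * real n) * (\<Sum>i<n. (noise (S i))\<^sup>2 - (noise (S i) - D i)\<^sup>2)"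
    unfolding emp_risk_def res res0 by (simp add: sum_subtractf right_diff_distrib)
  also have "(\<Sum>i<n. (noise (S i))\<^sup>2 - (noise (S i) - D i)\<^sup>2) = (\<Sum>i<n. 2 * (noise (S i) * D i) - (D i)\<^sup>2)"
    by (intro sum.cong refl) (simp add: power2_eq_square algebra_simps)
  also have "\<dots> = 2 * (\<Sum>j<p. (w j - wbar j) * noise_corr S j) - (\<Sum>i<n. (D i)\<^sup>2)"
    by (simp add: sum_subtractf sum_distrib_left[symmetric] corr)
  also have "1 / (2 * real n) * \<dots> = (\<Sum>j<p. (w j - wbar j) * (noise_corr S j / real n)) - (\<Sum>i<n. (D i)\<^sup>2) / (2 * real n)"
    by (simp add: diff_divide_distrib sum_divide_distrib)
  finally show ?thesis by (simp add: D_def)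
qed

lemma emp_risk_gap_le:
  assumes H: "\<And>j. j < p \<Longrightarrow> (noise_corr S j / real n)\<^sup>2 \<le> H"
    and sparse: "l0_norm p (\<lambda>j. w j - wbar j) \<le> 2 * k"
  shows "emp_risk p n S wbar - emp_risk p n S w
    \<le> sqrt H * (sqrt (2 * real k) * L2_set (\<lambda>j. w j - wbar j) {..<p})
      - (\<Sum>i<n. (dot p (\<lambda>j. w j - wbar j) (fst (S i)))\<^sup>2) / (2 * real n)"
proof -
  have H_nn: "0 \<le> H" using H[OF p_pos] zero_le_power2 order.trans by blast
  have "(\<Sum>j<p. (w j - wbar j) * (noise_corr S j / real n)) \<le> (\<Sum>j<p. \<bar>w j - wbar j\<bar> * sqrt H)"
  proof (intro sum_mono)
    fix j assume "j \<in> {..<p}"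
    then have "\<bar>noise_corr S j / real n\<bar> \<le> sqrt H" 
      using H[of j] by (intro real_le_rsqrt) (simp add: power_divide)
    then have "\<bar>w j - wbar j\<bar> * \<bar>noise_corr S j / real n\<bar> \<le> \<bar>w j - wbar j\<bar> * sqrt H"
      by (intro mult_left_mono) auto
    then show "(w j - wbar j) * (noise_corr S j / real n) \<le> \<bar>w j - wbar j\<bar> * sqrt H"
      using abs_ge_self[of "(w j - wbar j) * (noise_corr S j / real n)"] unfolding abs_mult by linarith
  qed
  also have "\<dots> = sqrt H * (\<Sum>j<p. \<bar>w j - wbar j\<bar>)" by (simp add: sum_distrib_left mult.commute)
  also have "\<dots> \<le> sqrt H * (sqrt (real (2 * k)) * L2_set (\<lambda>j. w j - wbar j) {..<p})"
    using H_nn by (intro mult_left_mono l1_le_sqrt_sparsity sparse) auto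
  finally show ?thesis unfolding emp_risk_gap by simp
qed

text \<open>
  With \<open>q = sqrt Q\<close> and \<open>b = sqrt (2 k H / lambda_min Cov)\<close>, optimality reads \<open>0 \<le> b q - q\<^sup>2 / 8192\<close>, hence \<open>q \<le> 8192 b\<close>,
  where \<open>8192 = 2 * 64\<^sup>2\<close>. The constant of the conclusion is \<open>2 * 8192\<^sup>2\<close>.
\<close>

lemma excess_and_gap_le_on_good_event:
  fixes w :: "nat \<Rightarrow> real"
  defines "\<Delta> \<equiv> \<lambda>j. w j - wbar j"
  assumes H: "\<And>j. j < p \<Longrightarrow> (noise_corr S j / real n)\<^sup>2 \<le> H"
    and sparse: "l0_norm p w \<le> k"
    and RE: "real n * sqrt (quad_form p Cov \<Delta>) / 64 \<le> (\<Sum>i<n. \<bar>dot p \<Delta> (fst (S i))\<bar>)"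
    and better: "emp_risk p n S w \<le> emp_risk p n S wbar"
  shows "quad_form p Cov \<Delta> \<le> 134217728 * (real k * H / lambda_min Cov)"
    and "emp_risk p n S wbar - emp_risk p n S w \<le> 134217728 * (real k * H / lambda_min Cov)"
proof -
  define q where "q = sqrt (quad_form p Cov \<Delta>)"
  have q: "0 \<le> q" "q\<^sup>2 = quad_form p Cov \<Delta>" using quad_form_Cov_nonneg by (auto simp: q_def)
  have H_nn: "0 \<le> H" using H[OF p_pos] zero_le_power2 order.trans by blast
  have n: "0 < real n" using n_pos by simp
  define b where "b = sqrt H * (sqrt (2 * real k) / sqrt (lambda_min Cov))"
  have b: "0 \<le> b" "b\<^sup>2 = 2 * (real k * H / lambda_min Cov)"
    using H_nn lambda_pos by (auto simp: b_def power_mult_distrib power_divide)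
  have sparse': "l0_norm p \<Delta> \<le> 2 * k"
    using l0_norm_diff_le[of p w wbar] sparse wbar_sparse by (simp add: \<Delta>_def)
  have quad: "q\<^sup>2 / 8192 \<le> (\<Sum>i<n. (dot p \<Delta> (fst (S i)))\<^sup>2) / (2 * real n)"
  proof -
    have "(real n * q / 64)\<^sup>2 \<le> (\<Sum>i<n. \<bar>dot p \<Delta> (fst (S i))\<bar>)\<^sup>2"
      using RE q n by (intro power_mono) (auto simp: q_def)
    also have "\<dots> \<le> (\<Sum>i<n. \<bar>dot p \<Delta> (fst (S i))\<bar>\<^sup>2) * (\<Sum>i<n. 1\<^sup>2)"
      using Cauchy_Schwarz_ineq_sum[of "\<lambda>i. \<bar>dot p \<Delta> (fst (S i))\<bar>" "\<lambda>_. 1" "{..<n}"] by simp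
    finally have "real n * (real n * q\<^sup>2) \<le> real n * (4096 * (\<Sum>i<n. (dot p \<Delta> (fst (S i)))\<^sup>2))"
      by (simp add: power2_eq_square mult_ac)
    then have "real n * q\<^sup>2 \<le> 4096 * (\<Sum>i<n. (dot p \<Delta> (fst (S i)))\<^sup>2)" using n by (rule mult_left_le_imp_le)
    then show ?thesis using n by (simp add: field_simps)
  qed
  have norm: "sqrt H * (sqrt (2 * real k) * L2_set \<Delta> {..<p}) \<le> b * q"
  proof -
    have "L2_set \<Delta> {..<p} \<le> q / sqrt (lambda_min Cov)"
      using lambda_le_quad_form[of \<Delta>] lambda_pos by (simp add: q_def le_divide_eq mult.commute)
    then have "sqrt H * (sqrt (2 * real k) * L2_set \<Delta> {..<p}) \<le> sqrt H * (sqrt (2 * real k) * (q / sqrt (lambda_min Cov)))"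
      using H_nn by (intro mult_left_mono) auto
    then show ?thesis by (simp add: b_def)
  qed
  have gap: "emp_risk p n S wbar - emp_risk p n S w \<le> b * q - q\<^sup>2 / 8192"
    using emp_risk_gap_le[OF H, of w] sparse' norm quad unfolding \<Delta>_def by linarith
  have "q * q \<le> (8192 * b) * q" using gap better by (simp add: power2_eq_square)
  then have qb: "q \<le> 8192 * b" using q(1) b(1) by (cases "q = 0") auto
  have "q\<^sup>2 \<le> (8192 * b)\<^sup>2" using qb q by (intro power_mono) auto
  then show "quad_form p Cov \<Delta> \<le> 134217728 * (real k * H / lambda_min Cov)"
    unfolding q(2) power_mult_distrib b(2) by simp
  have "emp_risk p n S wbar - emp_risk p n S w \<le> b * q" using gap zero_le_power2[of q] by linarith
  also have "\<dots> \<le> b * (8192 * b)" using qb b by (intro mult_left_mono) auto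
  also have "\<dots> = 8192 * b\<^sup>2" by (simp add: power2_eq_square)
  also have "\<dots> = 16384 * (real k * H / lambda_min Cov)" unfolding b(2) by simp
  also have "\<dots> \<le> 134217728 * (real k * H / lambda_min Cov)"
    using H_nn lambda_pos by (intro mult_right_mono) auto
  finally show "emp_risk p n S wbar - emp_risk p n S w \<le> 134217728 * (real k * H / lambda_min Cov)" .
qed

lemma excess_risk_eq: "risk p obs w - risk p obs wbar = quad_form p Cov (\<lambda>j. w j - wbar j) / 2"
proof -
  have "quad_form p Cov (\<lambda>j. wbar j - wbar j) = 0" by (simp add: quad_form_def)
  then show ?thesis unfolding risk_eq by (simp add: add_divide_distrib)
qed

lemma AE_w_hat:
  "AE S in sample. w_hat S \<in> W \<and> l0_norm p (w_hat S) \<le> k \<and> emp_risk p n S (w_hat S) \<le> emp_risk p n S wbar"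
  using w_hat_minimizer
  by eventually_elim (use wbar_domain wbar_sparse in \<open>auto simp: is_arg_min_def not_less\<close>)

text \<open>
  Disposes of the case \<open>k = 0\<close>, in which no lower bound on \<open>n\<close> is available.
\<close>

lemma agree_if_k_zero:
  assumes "k = 0" "l0_norm p w \<le> k" "j < p"
  shows "w j = wbar j"
proof -
  have *: "v j = 0" if "l0_norm p v \<le> k" for v
  proof -
    have "{j \<in> {..<p}. v j \<noteq> 0} = {}" using that assms(1) by (simp add: l0_norm_def)
    then show ?thesis using assms(3) by auto
  qed
  show ?thesis using *[OF assms(2)] *[OF wbar_sparse] by simp
qed

lemma measurable_w_hat_entry:
  assumes "j < p"
  shows "(\<lambda>S. w_hat S j) \<in> borel_measurable sample"
  using assms by (intro measurable_compose[OF w_hat_measurable] measurable_component_singleton) simp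

lemma measurable_excess: "(\<lambda>S. risk p obs (w_hat S) - risk p obs wbar) \<in> borel_measurable sample"
  unfolding excess_risk_eq quad_form_def
  by (intro borel_measurable_divide borel_measurable_sum borel_measurable_times borel_measurable_diff
      borel_measurable_const measurable_w_hat_entry) auto

lemma ln_p_ge: "1 / 2 \<le> ln (real p)"
  using p_ge_2 by (rule half_le_ln)

text \<open>
  The three exponentials are the failure probabilities of the restricted eigenvalue bound and the smallest confidence
  level at which the noise bound is applied. They are merged into one at the price of halving the exponent.
\<close>

lemma large_sample:
  assumes k: "0 < k" and n: "real n \<ge> 4 * real k * 10000 * ln (real p) / lambda_min Cov"
  shows "40000 * ln (real p) \<le> real n"
    and "exp (- real n / 512) + exp (- real n) + exp (- real n / 2) \<le> exp (- real n / 1024)"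
proof -
  have lnp: "0 \<le> ln (real p)" using ln_p_ge by simp
  have "1 * ln (real p) \<le> real k * ln (real p)" using k lnp by (intro mult_right_mono) auto
  moreover have "real k * ln (real p) * lambda_min Cov \<le> real k * ln (real p) * 1"
    using lambda_le_1 lnp by (intro mult_left_mono) auto
  then have "real k * ln (real p) \<le> real k * ln (real p) / lambda_min Cov"
    using lambda_pos by (simp add: le_divide_eq)
  moreover have "40000 * (real k * ln (real p) / lambda_min Cov) \<le> real n" using n by (simp add: mult_ac)
  ultimately show 1: "40000 * ln (real p) \<le> real n" by linarith
  have "3 \<le> exp (2::real)" using exp_ge_add_one_self[of "2::real"] by simp
  also have "\<dots> \<le> exp (real n / 1024)" using 1 ln_p_ge by simp
  finally have "3 * exp (- real n / 512) \<le> exp (real n / 1024) * exp (- real n / 512)"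
    by (intro mult_right_mono) auto
  also have "\<dots> = exp (- real n / 1024)" unfolding exp_add[symmetric] by (simp add: field_simps)
  finally have "3 * exp (- real n / 512) \<le> exp (- real n / 1024)" .
  moreover have "exp (- real n) \<le> exp (- real n / 512)" "exp (- real n / 2) \<le> exp (- real n / 512)" by simp_all
  ultimately show "exp (- real n / 512) + exp (- real n) + exp (- real n / 2) \<le> exp (- real n / 1024)" by linarith
qed

section \<open>The bound with high probability\<close>

text \<open>
  The noise bound holds at levels down to \<open>exp (- n / 2)\<close> only. For smaller \<open>\<delta>\<close> it is applied at that level: the bound on
  the noise only improves, and the additional failure probability fits into the term \<open>exp (- n / 1024)\<close>. The constant is
  \<open>8 * 134217728\<close>, from \<open>H = 8 \<sigma>\<^sup>2 l / n\<close> with \<open>l \<le> 2 ln (p / \<delta>)\<close>.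
\<close>

lemma excess_risk_high_probability:
  assumes n: "real n \<ge> 4 * real k * 10000 * ln (real p) / lambda_min Cov"
    and \<delta>: "0 < \<delta>" "\<delta> < 1 - exp (- (1 / 1024) * real n)"
  shows "\<P>(S in sample. risk p obs (w_hat S) - risk p obs wbar
      \<le> 1073741824 * (real k * \<sigma>\<^sup>2 * ln (real p / \<delta>) / (real n * (lambda_min Cov)\<^sup>2)))
    \<ge> 1 - \<delta> - exp (- (1 / 1024) * real n)"
proof -
  define rhs where "rhs = 1073741824 * (real k * \<sigma>\<^sup>2 * ln (real p / \<delta>) / (real n * (lambda_min Cov)\<^sup>2))"
  define T where "T = {S \<in> space sample. risk p obs (w_hat S) - risk p obs wbar \<le> rhs}"
  have T: "T \<in> sets sample"
    unfolding T_def by (intro borel_measurable_le measurable_excess borel_measurable_const)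
  have "1 - \<delta> - exp (- (1 / 1024) * real n) \<le> sample.prob T"
  proof (cases "k = 0")
    case True
    have "AE S in sample. S \<in> T"
      using AE_w_hat AE_space
    proof eventually_elim
      case (elim S)
      then have "quad_form p Cov (\<lambda>j. w_hat S j - wbar j) = 0"
        using agree_if_k_zero[OF True, of "w_hat S"] by (simp add: quad_form_def)
      then show ?case using elim by (simp add: T_def excess_risk_eq rhs_def True)
    qed
    then have "sample.prob T = 1" using T by (simp add: sample.prob_eq_1)
    then show ?thesis using \<delta>(1) exp_gt_zero[of "- (1 / 1024) * real n"] by linarith
  next
    case False
    then have k: "0 < k" by simp
    have n0: "0 < real n" using n_pos by simp
    note large = large_sample[OF k n]
    have \<delta>1: "\<delta> < 1" using \<delta> exp_gt_zero[of "- (1 / 1024) * real n"] by linarith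
    define \<delta>' where "\<delta>' = max \<delta> (exp (- real n / 2))"
    have \<delta>': "0 < \<delta>'" "\<delta>' \<le> 1" "\<delta> \<le> \<delta>'" using \<delta>(1) \<delta>1 by (auto simp: \<delta>'_def)
    define l where "l = ln (2 * real p / \<delta>')"
    have ln2p: "ln (2 * real p) \<le> 2 * ln (real p)" using p_ge_2 by (simp add: ln_mult)
    have "exp (- real n / 2) \<le> \<delta>'" by (simp add: \<delta>'_def)
    then have "2 * real p / \<delta>' \<le> 2 * real p / exp (- real n / 2)"
      using \<delta>'(1) by (intro divide_left_mono mult_pos_pos) auto
    then have "l \<le> ln (2 * real p / exp (- real n / 2))"
      unfolding l_def using \<delta>' p_pos by (intro ln_mono) auto
    also have "\<dots> = ln (2 * real p) + real n / 2" using p_pos by (simp add: ln_div)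
    also have "\<dots> \<le> real n" using ln2p large(1) ln_p_ge by linarith
    finally have l_n: "l \<le> real n" .
    have l_le: "l \<le> 2 * ln (real p / \<delta>)"
    proof -
      have "2 * real p / \<delta>' \<le> 2 * real p / \<delta>" using \<delta>(1) \<delta>' by (intro divide_left_mono) auto
      also have "\<dots> \<le> (real p / \<delta>)\<^sup>2"
      proof -
        have "2 \<le> real p / \<delta>" using \<delta>(1) \<delta>1 p_ge_2 by (simp add: le_divide_eq)
        then have "2 * (real p / \<delta>) \<le> real p / \<delta> * (real p / \<delta>)" using \<delta>(1) by (intro mult_right_mono) auto
        then show ?thesis by (simp add: power2_eq_square)
      qed
      finally have "l \<le> ln ((real p / \<delta>)\<^sup>2)" unfolding l_def using \<delta>' p_pos by (intro ln_mono) auto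
      also have "\<dots> = 2 * ln (real p / \<delta>)" using \<delta>(1) p_pos by (subst ln_realpow) auto
      finally show ?thesis .
    qed
    obtain G where G: "G \<in> sets sample" "sample.prob (space sample - G) \<le> exp (- real n / 512) + exp (- real n)"
      "\<And>S v. S \<in> G \<Longrightarrow> l0_norm p v \<le> 2 * k \<Longrightarrow>
         real n * sqrt (quad_form p Cov v) / 64 \<le> (\<Sum>i<n. \<bar>dot p v (fst (S i))\<bar>)"
      using restricted_eigenvalue[OF k n] by blast
    define N where "N = {S \<in> space sample. \<not> (\<forall>j<p. (noise_corr S j)\<^sup>2 \<le> 8 * \<sigma>\<^sup>2 * real n * l)}"
    have N: "N \<in> sets sample"
    proof -
      have "N = space sample - (\<Inter>j<p. {S \<in> space sample. (noise_corr S j)\<^sup>2 \<le> 8 * \<sigma>\<^sup>2 * real n * l})"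
        by (auto simp: N_def)
      moreover have "(\<Inter>j<p. {S \<in> space sample. (noise_corr S j)\<^sup>2 \<le> 8 * \<sigma>\<^sup>2 * real n * l}) \<in> sets sample"
        using p_pos by (intro sets.finite_INT borel_measurable_le borel_measurable_power measurable_noise_corr borel_measurable_const) auto
      ultimately show ?thesis by (simp add: sets.compl_sets)
    qed
    have prob_N: "sample.prob N \<le> \<delta>'"
      unfolding N_def l_def using l_n by (intro noise_corr_tail \<delta>') (simp add: l_def)
    define Bad where "Bad = (space sample - G) \<union> N"
    have Bad: "Bad \<in> sets sample" using G(1) N by (simp add: Bad_def)
    have "sample.prob Bad \<le> sample.prob (space sample - G) + sample.prob N"
      unfolding Bad_def using G(1) N by (intro measure_Un_le) auto
    also have "\<dots> \<le> \<delta> + exp (- real n / 1024)"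
    proof -
      have "\<delta>' \<le> \<delta> + exp (- real n / 2)" using \<delta>(1) by (simp add: \<delta>'_def)
      then show ?thesis using G(2) prob_N large(2) by linarith
    qed
    finally have prob_Bad: "sample.prob Bad \<le> \<delta> + exp (- real n / 1024)" .
    have "AE S in sample. S \<in> space sample - Bad \<longrightarrow> S \<in> T"
      using AE_w_hat AE_space
    proof eventually_elim
      case (elim S)
      show ?case
      proof
        assume S: "S \<in> space sample - Bad"
        define H where "H = 8 * \<sigma>\<^sup>2 * l / real n"
        have H: "(noise_corr S j / real n)\<^sup>2 \<le> H" if "j < p" for j
        proof -
          have "(noise_corr S j)\<^sup>2 \<le> 8 * \<sigma>\<^sup>2 * real n * l" using S that by (auto simp: Bad_def N_def)
          then have "(noise_corr S j)\<^sup>2 / (real n)\<^sup>2 \<le> 8 * \<sigma>\<^sup>2 * real n * l / (real n)\<^sup>2"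
            by (intro divide_right_mono) auto
          then show ?thesis using n0 by (simp add: H_def power_divide power2_eq_square)
        qed
        have sparse: "l0_norm p (\<lambda>j. w_hat S j - wbar j) \<le> 2 * k"
          using l0_norm_diff_le[of p "w_hat S" wbar] wbar_sparse elim by simp
        have "S \<in> G" using S by (auto simp: Bad_def)
        note excess = excess_and_gap_le_on_good_event(1)[OF H _ G(3)[OF this sparse]]
        have "risk p obs (w_hat S) - risk p obs wbar \<le> 134217728 * (real k * H / lambda_min Cov) / 2"
          unfolding excess_risk_eq using excess elim by (intro divide_right_mono) auto
        also have "\<dots> = 536870912 * (real k * \<sigma>\<^sup>2 * l / (real n * lambda_min Cov))"
          by (simp add: H_def mult_ac)
        also have "\<dots> \<le> 536870912 * (real k * \<sigma>\<^sup>2 * (2 * ln (real p / \<delta>)) / (real n * lambda_min Cov))"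
          using l_le lambda_pos by (intro mult_left_mono divide_right_mono) auto
        also have "\<dots> \<le> 536870912 * (real k * \<sigma>\<^sup>2 * (2 * ln (real p / \<delta>)) / (real n * (lambda_min Cov)\<^sup>2))"
        proof (intro mult_left_mono divide_left_mono)
          show "(lambda_min Cov)\<^sup>2 \<le> lambda_min Cov"
            using lambda_pos lambda_le_1 by (simp add: power2_eq_square mult_left_le)
          have "1 \<le> real p / \<delta>" using \<delta>(1) \<delta>1 p_ge_2 by (simp add: le_divide_eq)
          then show "0 \<le> real k * \<sigma>\<^sup>2 * (2 * ln (real p / \<delta>))" by simp
        qed (use n0 lambda_pos in auto)
        also have "\<dots> = rhs" by (simp add: rhs_def)
        finally show "S \<in> T" using elim by (simp add: T_def)
      qed
    qed
    then have "sample.prob (space sample - Bad) \<le> sample.prob T"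
      using T by (intro sample.finite_measure_mono_AE)
    moreover have "sample.prob (space sample - Bad) = 1 - sample.prob Bad"
      using Bad by (rule sample.prob_compl)
    ultimately show ?thesis using prob_Bad by simp
  qed
  then show ?thesis by (simp only: T_def rhs_def)
qed

section \<open>The bound in expectation\<close>

lemma emp_risk_eq_mean_loss: "emp_risk p n S w = (\<Sum>i<n. loss p w (S i)) / real n"
  by (simp add: emp_risk_def loss_def sum_divide_distrib[symmetric])

lemma
  shows integrable_emp_risk: "integrable sample (\<lambda>S. emp_risk p n S w)"
    and integral_emp_risk: "(\<integral>S. emp_risk p n S w \<partial>sample) = risk p obs w"
proof -
  have distr: "distr sample obs (\<lambda>S. S i) = obs" if "i < n" for i
    unfolding sample_law_def using that obs.prob_space_axioms by (intro distr_PiM_component) auto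
  have comp: "(\<lambda>S. S i) \<in> sample \<rightarrow>\<^sub>M obs" if "i < n" for i
    unfolding sample_law_def using that by (intro measurable_component_singleton) simp
  have loss_meas: "loss p w \<in> borel_measurable obs"
    using integrable_loss by (rule borel_measurable_integrable)
  have int: "integrable sample (\<lambda>S. loss p w (S i))" if "i < n" for i
    using integrable_distr[OF comp[OF that], of "loss p w"] integrable_loss by (simp add: distr[OF that])
  have eq: "(\<integral>S. loss p w (S i) \<partial>sample) = risk p obs w" if "i < n" for i
    using integral_distr[OF comp[OF that] loss_meas] by (simp add: distr[OF that] risk_def)
  show "integrable sample (\<lambda>S. emp_risk p n S w)"
    unfolding emp_risk_eq_mean_loss
    by (intro integrable_divide_zero Bochner_Integration.integrable_sum int) simp
  have "(\<integral>S. emp_risk p n S w \<partial>sample) = (\<Sum>i<n. \<integral>S. loss p w (S i) \<partial>sample) / real n"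
    unfolding emp_risk_eq_mean_loss
    by (subst integral_divide_zero, subst Bochner_Integration.integral_sum) (auto intro: int)
  also have "\<dots> = risk p obs w" using n_pos by (simp add: eq)
  finally show "(\<integral>S. emp_risk p n S w \<partial>sample) = risk p obs w" .
qed

lemma measurable_emp_risk_w_hat: "(\<lambda>S. emp_risk p n S (w_hat S)) \<in> borel_measurable sample"
proof -
  have dot: "(\<lambda>S. dot p (w_hat S) (fst (S i))) \<in> borel_measurable sample" if "i < n" for i
    unfolding dot_def
    by (rule borel_measurable_sum)
      (intro borel_measurable_times measurable_w_hat_entry measurable_design_entry that; simp)
  have snd: "(\<lambda>S. snd (S i)) \<in> borel_measurable sample" if "i < n" for i
    by (rule measurable_compose[OF measurable_sample_component[OF that] measurable_snd])
  show ?thesis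
    unfolding emp_risk_def
    by (intro borel_measurable_times borel_measurable_const borel_measurable_sum borel_measurable_power
        borel_measurable_diff dot snd) auto
qed

lemma quad_form_le_of_bounded:
  assumes R: "L2_set w {..<p} \<le> R" "L2_set wbar {..<p} \<le> R"
    and X: "AE x in Dx. L2_set x {..<p} \<le> 1"
  shows "L2_set (\<lambda>j. w j - wbar j) {..<p} \<le> 2 * R"
    and "quad_form p Cov (\<lambda>j. w j - wbar j) \<le> 4 * R\<^sup>2"
proof -
  define \<Delta> where "\<Delta> = (\<lambda>j. w j - wbar j)"
  have "L2_set \<Delta> {..<p} \<le> L2_set w {..<p} + L2_set (\<lambda>j. - wbar j) {..<p}"
    using L2_set_triangle_ineq[of w "\<lambda>j. - wbar j" "{..<p}"] by (simp add: \<Delta>_def)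
  also have "L2_set (\<lambda>j. - wbar j) {..<p} = L2_set wbar {..<p}" by (simp add: L2_set_def)
  finally have norm: "L2_set \<Delta> {..<p} \<le> 2 * R" using R by simp
  then show "L2_set (\<lambda>j. w j - wbar j) {..<p} \<le> 2 * R" by (simp add: \<Delta>_def)
  have "AE x in Dx. dot p \<Delta> x * dot p \<Delta> x \<le> 4 * R\<^sup>2"
    using X
  proof eventually_elim
    case (elim x)
    have "\<bar>dot p \<Delta> x\<bar> \<le> (\<Sum>j<p. \<bar>\<Delta> j\<bar> * \<bar>x j\<bar>)"
      unfolding dot_def by (rule order.trans[OF sum_abs]) (simp add: abs_mult)
    also have "\<dots> \<le> L2_set \<Delta> {..<p} * L2_set x {..<p}" by (rule L2_set_mult_ineq)
    also have "\<dots> \<le> 2 * R * 1" using norm elim order.trans[OF L2_set_nonneg norm] by (intro mult_mono) auto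
    finally have "\<bar>dot p \<Delta> x\<bar>\<^sup>2 \<le> (2 * R)\<^sup>2" by (intro power_mono) auto
    then show ?case by (simp add: power2_eq_square)
  qed
  then have "(\<integral>x. dot p \<Delta> x * dot p \<Delta> x \<partial>Dx) \<le> (\<integral>x. 4 * R\<^sup>2 \<partial>Dx)"
    by (intro integral_mono_AE integrable_dot_product) auto
  then show "quad_form p Cov (\<lambda>j. w j - wbar j) \<le> 4 * R\<^sup>2"
    by (simp add: integral_dot_product quad_form_eq_bilin \<Delta>_def X.prob_space)
qed

context
  fixes R :: real
  assumes W_bounded: "\<forall>w \<in> W. L2_set w {..<p} \<le> R"
    and X_bounded: "AE x in Dx. L2_set x {..<p} \<le> 1"
begin

lemma AE_excess_bounds:
  "AE S in sample. 0 \<le> risk p obs (w_hat S) - risk p obs wbar \<and> risk p obs (w_hat S) - risk p obs wbar \<le> 2 * R\<^sup>2"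
  using AE_w_hat
proof eventually_elim
  case (elim S)
  then show ?case
    using quad_form_le_of_bounded(2)[of "w_hat S" R] W_bounded wbar_domain X_bounded quad_form_Cov_nonneg
    by (simp add: excess_risk_eq)
qed

lemma integrable_excess: "integrable sample (\<lambda>S. risk p obs (w_hat S) - risk p obs wbar)"
  using AE_excess_bounds
  by (intro sample.integrable_const_bound[where B = "2 * R\<^sup>2"] measurable_excess)
    (auto elim: eventually_mono)

lemma emp_risk_nonneg: "0 \<le> emp_risk p n S w"
  unfolding emp_risk_def by (intro mult_nonneg_nonneg sum_nonneg) auto

lemma integrable_emp_risk_w_hat: "integrable sample (\<lambda>S. emp_risk p n S (w_hat S))"
proof (rule Bochner_Integration.integrable_bound[OF integrable_emp_risk[of wbar] measurable_emp_risk_w_hat])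
  show "AE S in sample. norm (emp_risk p n S (w_hat S)) \<le> norm (emp_risk p n S wbar)"
    using AE_w_hat by eventually_elim (simp add: emp_risk_nonneg)
qed

lemma integrable_generalization_gap:
  "integrable sample (\<lambda>S. risk p obs (w_hat S) - emp_risk p n S (w_hat S))"
proof -
  have "integrable sample (\<lambda>S. (risk p obs (w_hat S) - risk p obs wbar) + risk p obs wbar - emp_risk p n S (w_hat S))"
    by (intro Bochner_Integration.integrable_diff Bochner_Integration.integrable_add
        integrable_excess integrable_emp_risk_w_hat) simp
  then show ?thesis by simp
qed

text \<open>
  The empirical risk at the fixed parameter \<open>wbar\<close> is an unbiased estimate of its risk, so replacing one by the other does not
  change the expectation.
\<close>

lemma expected_generalization_gap:
  "(\<integral>S. risk p obs (w_hat S) - emp_risk p n S (w_hat S) \<partial>sample)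
    = (\<integral>S. (risk p obs (w_hat S) - risk p obs wbar) + (emp_risk p n S wbar - emp_risk p n S (w_hat S)) \<partial>sample)"
proof -
  have "(\<integral>S. (risk p obs (w_hat S) - risk p obs wbar) + (emp_risk p n S wbar - emp_risk p n S (w_hat S)) \<partial>sample)
      = (\<integral>S. (risk p obs (w_hat S) - emp_risk p n S (w_hat S)) + (emp_risk p n S wbar - risk p obs wbar) \<partial>sample)"
    by (intro Bochner_Integration.integral_cong) auto
  also have "\<dots> = (\<integral>S. risk p obs (w_hat S) - emp_risk p n S (w_hat S) \<partial>sample)
      + (\<integral>S. emp_risk p n S wbar - risk p obs wbar \<partial>sample)"
    by (intro Bochner_Integration.integral_add integrable_generalization_gap
        Bochner_Integration.integrable_diff integrable_emp_risk) simp
  also have "(\<integral>S. emp_risk p n S wbar - risk p obs wbar \<partial>sample) = 0"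
    using integrable_emp_risk[of wbar] by (simp add: integral_emp_risk sample.prob_space)
  finally show ?thesis by simp
qed

lemma integrable_excess_plus_gap:
  "integrable sample (\<lambda>S. (risk p obs (w_hat S) - risk p obs wbar) + (emp_risk p n S wbar - emp_risk p n S (w_hat S)))"
  by (intro Bochner_Integration.integrable_add Bochner_Integration.integrable_diff
      integrable_excess integrable_emp_risk integrable_emp_risk_w_hat)

lemma expected_excess_le_gap:
  "(\<integral>S. risk p obs (w_hat S) - risk p obs wbar \<partial>sample)
    \<le> (\<integral>S. risk p obs (w_hat S) - emp_risk p n S (w_hat S) \<partial>sample)"
  unfolding expected_generalization_gap
  by (intro integral_mono_AE integrable_excess integrable_excess_plus_gap)
    (use AE_w_hat in \<open>auto elim: eventually_mono\<close>)

text \<open>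
  The empirical risk is nonnegative, and the risk of a parameter in the domain is bounded.
\<close>

lemma expected_gap_small_sample:
  "(\<integral>S. risk p obs (w_hat S) - emp_risk p n S (w_hat S) \<partial>sample) \<le> 2 * R\<^sup>2 + 4 * exp (\<sigma>\<^sup>2 / 2)"
proof -
  have "risk p obs wbar = noise_var / 2" unfolding risk_eq by (simp add: quad_form_def)
  also have "\<dots> \<le> 4 * exp (\<sigma>\<^sup>2 / 2)" using noise_var_le by simp
  finally have r: "risk p obs wbar \<le> 4 * exp (\<sigma>\<^sup>2 / 2)" .
  have "AE S in sample. risk p obs (w_hat S) - emp_risk p n S (w_hat S) \<le> 2 * R\<^sup>2 + 4 * exp (\<sigma>\<^sup>2 / 2)"
    using AE_excess_bounds
  proof eventually_elim
    case (elim S)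
    then show ?case using r emp_risk_nonneg[of S "w_hat S"] by linarith
  qed
  then have "(\<integral>S. risk p obs (w_hat S) - emp_risk p n S (w_hat S) \<partial>sample)
      \<le> (\<integral>S. 2 * R\<^sup>2 + 4 * exp (\<sigma>\<^sup>2 / 2) \<partial>sample)"
    by (intro integral_mono_AE integrable_generalization_gap) auto
  then show ?thesis by (simp add: sample.prob_space)
qed

lemma expected_gap_k_zero:
  assumes "k = 0"
  shows "(\<integral>S. risk p obs (w_hat S) - emp_risk p n S (w_hat S) \<partial>sample) = 0"
proof -
  have "AE S in sample. (risk p obs (w_hat S) - risk p obs wbar) + (emp_risk p n S wbar - emp_risk p n S (w_hat S)) = 0"
    using AE_w_hat
  proof eventually_elim
    case (elim S)
    then have "\<forall>j<p. w_hat S j = wbar j" using agree_if_k_zero[OF assms] by blast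
    then have "dot p (w_hat S) x = dot p wbar x" for x by (simp add: dot_def)
    then show ?case by (simp add: risk_def loss_def[abs_def] emp_risk_def)
  qed
  then have "(\<integral>S. (risk p obs (w_hat S) - risk p obs wbar) + (emp_risk p n S wbar - emp_risk p n S (w_hat S)) \<partial>sample) = 0"
    by (rule integral_eq_zero_AE)
  then show ?thesis unfolding expected_generalization_gap .
qed

text \<open>
  The good event is that of the restricted eigenvalue bound; the noise enters through the majorant of its
  squared correlations and needs no event of its own. On the bad event \<open>\<parallel>\<Delta>\<parallel> \<le> 2R\<close>, and the
  product \<open>sqrt (2 k H) * 2R\<close> is split by the inequality between the arithmetic and the geometric mean, so that \<open>k H\<close> can be integrated over
  the whole space and only \<open>4 R\<^sup>2\<close> meets the probability of the bad event. The constant is \<open>40 * 268435456\<close>: the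
  factor \<open>40\<close> of the second moment bound times \<open>2 * 134217728\<close> for the sum of the two terms on the good event.
\<close>

lemma expected_gap_large_sample:
  assumes k: "0 < k" and n: "real n \<ge> 4 * real k * 10000 * ln (real p) / lambda_min Cov" and \<sigma>: "\<sigma> \<noteq> 0"
  shows "(\<integral>S. risk p obs (w_hat S) - emp_risk p n S (w_hat S) \<partial>sample)
    \<le> 10737418240 * (real k * \<sigma>\<^sup>2 * ln (real p) / (real n * (lambda_min Cov)\<^sup>2))
      + 4 * R\<^sup>2 * exp (- (1 / 1024) * real n)"
proof -
  define lam where "lam = lambda_min Cov"
  have lam: "0 < lam" "lam \<le> 1" using lambda_pos lambda_le_1 by (auto simp: lam_def)
  note large = large_sample[OF k n]
  obtain G where G: "G \<in> sets sample" "sample.prob (space sample - G) \<le> exp (- real n / 512) + exp (- real n)"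
    "\<And>S v. S \<in> G \<Longrightarrow> l0_norm p v \<le> 2 * k \<Longrightarrow>
       real n * sqrt (quad_form p Cov v) / 64 \<le> (\<Sum>i<n. \<bar>dot p v (fst (S i))\<bar>)"
    using restricted_eigenvalue[OF k n] by blast
  have "ln (2 * real p) \<le> 2 * ln (real p)" using p_ge_2 by (simp add: ln_mult)
  then have "ln (2 * real p) \<le> real n" using large(1) ln_p_ge by linarith
  from noise_corr_second_moment[OF \<sigma> this]
  obtain H where H: "integrable sample H" "\<And>S. 0 \<le> H S" "\<And>S j. j < p \<Longrightarrow> (noise_corr S j / real n)\<^sup>2 \<le> H S"
    "(\<integral>S. H S \<partial>sample) \<le> 40 * \<sigma>\<^sup>2 * ln (real p) / real n" by blast
  define B where "B S = 268435456 * (real k * H S / lam) + 4 * R\<^sup>2 * indicator (space sample - G) S" for S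
  have int1: "integrable sample (\<lambda>S. 268435456 * (real k * H S / lam))"
    by (intro integrable_mult_right integrable_divide_zero H(1))
  have Gc: "space sample - G \<in> sets sample" using G(1) by (rule sets.compl_sets)
  have int2: "integrable sample (\<lambda>S. 4 * R\<^sup>2 * indicator (space sample - G) S)"
    using Gc by (intro integrable_mult_right integrable_real_indicator) (simp_all add: less_top[symmetric])
  have B_int: "integrable sample B"
    unfolding B_def by (intro Bochner_Integration.integrable_add int1 int2)
  have "AE S in sample. (risk p obs (w_hat S) - risk p obs wbar) + (emp_risk p n S wbar - emp_risk p n S (w_hat S)) \<le> B S"
    using AE_w_hat AE_excess_bounds AE_space
  proof eventually_elim
    case (elim S)
    define \<Delta> where "\<Delta> = (\<lambda>j. w_hat S j - wbar j)"
    have sparse: "l0_norm p \<Delta> \<le> 2 * k"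
      using l0_norm_diff_le[of p "w_hat S" wbar] wbar_sparse elim by (simp add: \<Delta>_def)
    have kH: "0 \<le> real k * H S / lam" using H(2) lam by simp
    show ?case
    proof (cases "S \<in> G")
      case True
      have RE: "real n * sqrt (quad_form p Cov \<Delta>) / 64 \<le> (\<Sum>i<n. \<bar>dot p \<Delta> (fst (S i))\<bar>)"
        using G(3)[OF True sparse] .
      note good = excess_and_gap_le_on_good_event[OF H(3) _ RE[unfolded \<Delta>_def]]
      define r where "r = real k * H S / lam"
      have "quad_form p Cov \<Delta> / 2 \<le> 134217728 * r"
        unfolding r_def using good(1) elim quad_form_Cov_nonneg[of \<Delta>] by (simp add: \<Delta>_def lam_def)
      moreover have "emp_risk p n S wbar - emp_risk p n S (w_hat S) \<le> 134217728 * r"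
        unfolding r_def using good(2) elim by (simp add: lam_def)
      moreover have "B S = 268435456 * r" using True by (simp add: B_def r_def)
      ultimately show ?thesis unfolding excess_risk_eq \<Delta>_def[symmetric] by linarith
    next
      case False
      have norm: "L2_set \<Delta> {..<p} \<le> 2 * R"
        unfolding \<Delta>_def using W_bounded wbar_domain elim X_bounded by (intro quad_form_le_of_bounded(1)) auto
      have "emp_risk p n S wbar - emp_risk p n S (w_hat S) \<le> sqrt (H S) * (sqrt (2 * real k) * L2_set \<Delta> {..<p})"
      proof -
        have "0 \<le> (\<Sum>i<n. (dot p \<Delta> (fst (S i)))\<^sup>2) / (2 * real n)" by (simp add: sum_nonneg)
        then show ?thesis using emp_risk_gap_le[OF H(3), of "w_hat S" S] sparse unfolding \<Delta>_def by linarith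
      qed
      also have "\<dots> \<le> sqrt (H S) * (sqrt (2 * real k) * (2 * R))"
        using norm H(2) by (intro mult_left_mono) auto
      also have "\<dots> = sqrt (2 * real k * H S) * (2 * R)" by (simp add: real_sqrt_mult)
      also have "\<dots> \<le> real k * H S + 2 * R\<^sup>2"
        using sum_squares_bound[of "sqrt (2 * real k * H S)" "2 * R"] H(2)[of S] by (simp add: power_mult_distrib)
      also have "real k * H S \<le> real k * H S / lam"
        using lam H(2)[of S] by (simp add: le_divide_eq mult_left_le)
      also have "real k * H S / lam \<le> 268435456 * (real k * H S / lam)"
        using mult_right_mono[OF _ kH, of 1 268435456] by simp
      finally show ?thesis using elim False by (simp add: B_def)
    qed
  qed
  then have "(\<integral>S. risk p obs (w_hat S) - emp_risk p n S (w_hat S) \<partial>sample) \<le> (\<integral>S. B S \<partial>sample)"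
    unfolding expected_generalization_gap by (intro integral_mono_AE integrable_excess_plus_gap B_int)
  also have "\<dots> = 268435456 * (real k * (\<integral>S. H S \<partial>sample) / lam) + 4 * R\<^sup>2 * sample.prob (space sample - G)"
    unfolding B_def Bochner_Integration.integral_add[OF int1 int2] using Gc by simp
  also have "\<dots> \<le> 268435456 * (real k * (40 * \<sigma>\<^sup>2 * ln (real p) / real n) / lam) + 4 * R\<^sup>2 * exp (- (1 / 1024) * real n)"
  proof (intro add_mono mult_left_mono divide_right_mono H(4))
    show "sample.prob (space sample - G) \<le> exp (- (1 / 1024) * real n)"
    proof -
      have "sample.prob (space sample - G) \<le> exp (- real n / 1024)"
        using G(2) large(2) exp_ge_zero[of "- real n / 2"] by linarith
      then show ?thesis by simp
    qed
  qed (use lam in auto)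
  also have "268435456 * (real k * (40 * \<sigma>\<^sup>2 * ln (real p) / real n) / lam)
      = 10737418240 * (real k * \<sigma>\<^sup>2 * ln (real p) / (real n * lam))" by simp
  also have "\<dots> \<le> 10737418240 * (real k * \<sigma>\<^sup>2 * ln (real p) / (real n * lam\<^sup>2))"
  proof (intro mult_left_mono divide_left_mono)
    show "lam\<^sup>2 \<le> lam" using lam by (simp add: power2_eq_square mult_left_le)
    show "0 \<le> real k * \<sigma>\<^sup>2 * ln (real p)" using ln_p_ge by simp
  qed (use n_pos lam in auto)
  finally show ?thesis by (simp add: lam_def)
qed

end

text \<open>
  The assumption on \<open>exp (- n / 1024)\<close> excludes \<open>\<sigma> = 0\<close>. If \<open>n\<close> is below the threshold of the restricted eigenvalue bound, then
  \<open>1 \<le> (40000 / \<sigma>\<^sup>2) rate\<close>, and the constant bound \<open>K\<close> on the expectation is of the order of the rate.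
\<close>

lemma excess_risk_expectation:
  assumes R: "0 < R" and W_bounded: "\<forall>w \<in> W. L2_set w {..<p} \<le> R"
    and X_bounded: "AE x in Dx. L2_set x {..<p} \<le> 1"
    and small: "exp (- (1 / 1024) * real n) \<le> min 0.5 ((\<sigma>\<^sup>2 * (72 + 16 * ln (real p)) / real n) / (4 * R\<^sup>2))"
  shows "(\<integral>S. risk p obs (w_hat S) - emp_risk p n S (w_hat S) \<partial>sample)
    \<le> (10737418400 + 40000 * (2 * R\<^sup>2 + 4 * exp (\<sigma>\<^sup>2 / 2)) / \<sigma>\<^sup>2)
      * (real k * \<sigma>\<^sup>2 * ln (real p) / (real n * (lambda_min Cov)\<^sup>2))"
proof -
  define lam where "lam = lambda_min Cov"
  have lam: "0 < lam" "lam \<le> 1" using lambda_pos lambda_le_1 by (auto simp: lam_def)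
  have lam2: "lam\<^sup>2 \<le> lam" "0 < lam\<^sup>2" using lam by (auto simp: power2_eq_square mult_left_le)
  have n0: "0 < real n" using n_pos by simp
  have \<sigma>: "\<sigma> \<noteq> 0"
  proof
    assume "\<sigma> = 0"
    then have "exp (- (1 / 1024) * real n) \<le> 0" using small by simp
    then show False using exp_gt_zero[of "- (1 / 1024) * real n"] by linarith
  qed
  define K where "K = 2 * R\<^sup>2 + 4 * exp (\<sigma>\<^sup>2 / 2)"
  have K: "0 \<le> K" by (simp add: K_def)
  define rate where "rate = real k * \<sigma>\<^sup>2 * ln (real p) / (real n * lam\<^sup>2)"
  have rate: "0 \<le> rate" using ln_p_ge by (simp add: rate_def)
  have "(\<integral>S. risk p obs (w_hat S) - emp_risk p n S (w_hat S) \<partial>sample)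
    \<le> (10737418400 + 40000 * K / \<sigma>\<^sup>2) * rate"
  proof (cases "k = 0")
    case True
    show ?thesis
      using expected_gap_k_zero[OF W_bounded X_bounded True] rate K by simp
  next
    case False
    then have k: "1 \<le> real k" by simp
    show ?thesis
    proof (cases "real n \<ge> 4 * real k * 10000 * ln (real p) / lambda_min Cov")
      case True
      define ex where "ex = exp (- (1 / 1024) * real n)"
      have "ex \<le> (\<sigma>\<^sup>2 * (72 + 16 * ln (real p)) / real n) / (4 * R\<^sup>2)" using small by (simp add: ex_def)
      then have "4 * R\<^sup>2 * ex \<le> \<sigma>\<^sup>2 * (72 + 16 * ln (real p)) / real n"
        using R by (simp only: pos_le_divide_eq[OF mult_pos_pos[OF zero_less_numeral zero_less_power[OF R]]] mult.commute[of ex])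
      \<comment> \<open>\<open>72 \<le> 144 ln p\<close>, since \<open>ln p \<ge> 1/2\<close>.\<close>
      also have "\<dots> \<le> \<sigma>\<^sup>2 * (160 * ln (real p)) / real n"
        using ln_p_ge by (intro divide_right_mono mult_left_mono) auto
      also have "\<dots> = 160 * (1 * \<sigma>\<^sup>2 * ln (real p) / real n)" by simp
      also have "\<dots> \<le> 160 * rate"
        unfolding rate_def
      proof (intro mult_left_mono frac_le mult_right_mono k)
        have "real n * lam\<^sup>2 \<le> real n * 1" using lam lam2 by (intro mult_left_mono) auto
        then show "real n * lam\<^sup>2 \<le> real n" by simp
        show "0 < real n * lam\<^sup>2" using n0 lam2 by (intro mult_pos_pos)
      qed (use ln_p_ge in auto)
      finally have "4 * R\<^sup>2 * ex \<le> 160 * rate" .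
      moreover have "(\<integral>S. risk p obs (w_hat S) - emp_risk p n S (w_hat S) \<partial>sample) \<le> 10737418240 * rate + 4 * R\<^sup>2 * ex"
        using expected_gap_large_sample[OF W_bounded X_bounded _ True \<sigma>] False by (simp add: rate_def ex_def lam_def)
      moreover have "0 \<le> 40000 * K / \<sigma>\<^sup>2 * rate" using K rate by simp
      ultimately show ?thesis by (simp only: distrib_right)
    next
      case False
      then have "real n * lam \<le> 40000 * (real k * ln (real p))"
        using lam by (simp add: lam_def not_le less_divide_eq)
      moreover have "real n * lam\<^sup>2 \<le> real n * lam" using lam2 by (intro mult_left_mono) auto
      ultimately have "(real n * lam\<^sup>2) * \<sigma>\<^sup>2 \<le> 40000 * (real k * ln (real p)) * \<sigma>\<^sup>2"
        by (intro mult_right_mono) auto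
      then have "1 \<le> 40000 / \<sigma>\<^sup>2 * rate"
        using n0 lam2 \<sigma> by (simp add: rate_def field_simps)
      then have "K * 1 \<le> K * (40000 / \<sigma>\<^sup>2 * rate)" using K by (rule mult_left_mono)
      moreover have "(\<integral>S. risk p obs (w_hat S) - emp_risk p n S (w_hat S) \<partial>sample) \<le> K"
        unfolding K_def by (rule expected_gap_small_sample[OF W_bounded X_bounded])
      moreover have "(10737418400 + 40000 * K / \<sigma>\<^sup>2) * rate = 10737418400 * rate + K * (40000 / \<sigma>\<^sup>2 * rate)"
        by (simp add: distrib_right)
      ultimately show ?thesis using rate by linarith
    qed
  qed
  then show ?thesis by (simp only: rate_def K_def lam_def)
qed

end

section \<open>The two bounds\<close>

theorem corollary1:
  shows "\<exists>c0 c1 :: real. c0 > 0 \<and> c1 > 0 \<and>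
    (\<forall>\<sigma> lmin lmax :: real. \<exists>C > 0.
      \<forall>p n k W wbar Dx De Cov w_hat. \<forall>\<delta> :: real.
        sparse_regression \<sigma> p n k W wbar Dx De Cov w_hat \<longrightarrow>
        lambda_min Cov = lmin \<longrightarrow> lambda_max Cov = lmax \<longrightarrow>
        real n \<ge> 4 * real k * c1 * ln (real p) / lambda_min Cov \<longrightarrow>
        0 < \<delta> \<longrightarrow> \<delta> < 1 - exp (- c0 * real n) \<longrightarrow>
        \<P>(S in sample_law n p wbar Dx De.
            risk p (obs_law p wbar Dx De) (w_hat S) - risk p (obs_law p wbar Dx De) wbar
              \<le> C * (real k * \<sigma>\<^sup>2 * ln (real p / \<delta>) / (real n * (lambda_min Cov)\<^sup>2)))
          \<ge> 1 - \<delta> - exp (- c0 * real n)) \<and>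
    (\<forall>\<sigma> lmin lmax R :: real. \<exists>C > 0.
      \<forall>p n k W wbar Dx De Cov w_hat.
        sparse_regression \<sigma> p n k W wbar Dx De Cov w_hat \<longrightarrow>
        lambda_min Cov = lmin \<longrightarrow> lambda_max Cov = lmax \<longrightarrow>
        R > 0 \<longrightarrow> (\<forall>w \<in> W. L2_set w {..<p} \<le> R) \<longrightarrow>
        (AE x in Dx. L2_set x {..<p} \<le> 1) \<longrightarrow>
        exp (- c0 * real n) \<le> min 0.5 ((\<sigma>\<^sup>2 * (72 + 16 * ln (real p)) / real n) / (4 * R\<^sup>2)) \<longrightarrow>
        (let M = sample_law n p wbar Dx De; F = risk p (obs_law p wbar Dx De) in
          integrable M (\<lambda>S. F (w_hat S) - F wbar) \<and>
          integrable M (\<lambda>S. F (w_hat S) - emp_risk p n S (w_hat S)) \<and>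
          (\<integral>S. F (w_hat S) - F wbar \<partial>M)
            \<le> (\<integral>S. F (w_hat S) - emp_risk p n S (w_hat S) \<partial>M) \<and>
          (\<integral>S. F (w_hat S) - emp_risk p n S (w_hat S) \<partial>M)
            \<le> C * (real k * \<sigma>\<^sup>2 * ln (real p) / (real n * (lambda_min Cov)\<^sup>2))))"
proof (rule exI[of _ "1 / 1024"], rule exI[of _ 10000], intro conjI)
  \<comment> \<open>The restricted eigenvalue bound fails with probability of order \<open>exp (- n / 512)\<close>; half of this exponent
    absorbs the other error terms. The grid has at most \<open>exp (26 k ln p / lambda_min Cov)\<close> points, and \<open>26 * 512 \<le> 4 * 10000\<close>.\<close>
  show "(0::real) < 1 / 1024" "(0::real) < 10000" by simp_all
  show "\<forall>\<sigma> lmin lmax :: real. \<exists>C > 0.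
      \<forall>p n k W wbar Dx De Cov w_hat. \<forall>\<delta> :: real.
        sparse_regression \<sigma> p n k W wbar Dx De Cov w_hat \<longrightarrow>
        lambda_min Cov = lmin \<longrightarrow> lambda_max Cov = lmax \<longrightarrow>
        real n \<ge> 4 * real k * 10000 * ln (real p) / lambda_min Cov \<longrightarrow>
        0 < \<delta> \<longrightarrow> \<delta> < 1 - exp (- (1 / 1024) * real n) \<longrightarrow>
        \<P>(S in sample_law n p wbar Dx De.
            risk p (obs_law p wbar Dx De) (w_hat S) - risk p (obs_law p wbar Dx De) wbar
              \<le> C * (real k * \<sigma>\<^sup>2 * ln (real p / \<delta>) / (real n * (lambda_min Cov)\<^sup>2)))
          \<ge> 1 - \<delta> - exp (- (1 / 1024) * real n)"
    by (intro allI, rule exI[of _ "1073741824"], intro conjI allI impI)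
      (simp, rule sparse_regression.excess_risk_high_probability)
  show "\<forall>\<sigma> lmin lmax R :: real. \<exists>C > 0.
      \<forall>p n k W wbar Dx De Cov w_hat.
        sparse_regression \<sigma> p n k W wbar Dx De Cov w_hat \<longrightarrow>
        lambda_min Cov = lmin \<longrightarrow> lambda_max Cov = lmax \<longrightarrow>
        R > 0 \<longrightarrow> (\<forall>w \<in> W. L2_set w {..<p} \<le> R) \<longrightarrow>
        (AE x in Dx. L2_set x {..<p} \<le> 1) \<longrightarrow>
        exp (- (1 / 1024) * real n) \<le> min 0.5 ((\<sigma>\<^sup>2 * (72 + 16 * ln (real p)) / real n) / (4 * R\<^sup>2)) \<longrightarrow>
        (let M = sample_law n p wbar Dx De; F = risk p (obs_law p wbar Dx De) in
          integrable M (\<lambda>S. F (w_hat S) - F wbar) \<and>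
          integrable M (\<lambda>S. F (w_hat S) - emp_risk p n S (w_hat S)) \<and>
          (\<integral>S. F (w_hat S) - F wbar \<partial>M)
            \<le> (\<integral>S. F (w_hat S) - emp_risk p n S (w_hat S) \<partial>M) \<and>
          (\<integral>S. F (w_hat S) - emp_risk p n S (w_hat S) \<partial>M)
            \<le> C * (real k * \<sigma>\<^sup>2 * ln (real p) / (real n * (lambda_min Cov)\<^sup>2)))"
  proof (intro allI, goal_cases)
    case (1 \<sigma> lmin lmax R)
    define C where "C = 10737418400 + 40000 * (2 * R\<^sup>2 + 4 * exp (\<sigma>\<^sup>2 / 2)) / \<sigma>\<^sup>2"
    have "0 \<le> 40000 * (2 * R\<^sup>2 + 4 * exp (\<sigma>\<^sup>2 / 2)) / \<sigma>\<^sup>2" by simp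
    then have "0 < C" unfolding C_def by linarith
    then show ?case
      unfolding Let_def C_def
      by (intro exI[of _ C, unfolded C_def] conjI allI impI sparse_regression.integrable_excess
          sparse_regression.integrable_generalization_gap sparse_regression.expected_excess_le_gap
          sparse_regression.excess_risk_expectation) assumption+
  qed
qed

end
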